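(* In $\mathbb{Q}S_n[[u]]$ we have $$\sum_{f\in\mathcal M_n}\Pi(f)\,u^{\ell(f)}=\sum_{f\in\mathcal I_n}\Pi(f)(-1)^{\ell(f)}(-u)^{d(f)}.$$ This identity continues to hold if $\mathcal M_n$ and $\mathcal I_n$ are replaced by their subsets consisting of transitive factorizations of any fixed genus $g$.
   Context: Permutations are multiplied right to left. For a factorization $f=(\sigma_1,\ldots,\sigma_r)$ in $S_n$, $\ell(f)=r$ and $\Pi(f)=\sigma_1\cdots\sigma_r$ (empty factorization: length 0, target identity). Its depth $d(f)=\sum_j(j-1)\beta_j$, where $\beta_j$ is the total number of disjoint $j$-cycles among all factors. It is transitive if its factors generate a transitive subgroup of $S_n$, and then its genus is the $g\ge0$ with $d(f)=n+\ell(\Pi(f))-2+2g$, where $\ell$ of a permutation is its number of cycles. $\mathcal M_n$ is the set of monotone factorizations in $S_n$, i.e. factorizations $(a_1\,b_1)\cdots(a_r\,b_r)$ into transpositions with $a_i<b_i$ and $b_1\le b_2\le\cdots\le b_r$, including the empty one. A cycle factorization is one whose factors are all nontrivial cycles; two are equivalent if one is obtained from the other by repeatedly interchanging adjacent disjoint factors; $\mathcal I_n$ is the set of equivalence classes (inequivalent factorizations), including the empty one. *)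

theory Defs
  imports
    "HOL-Analysis.Analysis"
    "HOL-Computational_Algebra.Formal_Power_Series"
    "HOL-Combinatorics.Perm"
    "HOL-Library.Poly_Mapping"
begin

subsection \<open>The symmetric group and its group algebra\<close>

text \<open>Multiplication of type \<open>nat perm\<close> is composition of functions, i.e. right to left.\<close>

definition Sym :: "nat \<Rightarrow> nat perm set" where
  "Sym n = {\<sigma>. affected \<sigma> \<subseteq> {1..n}}"

text \<open>
  The product on \<open>'a \<Rightarrow>\<^sub>0 rat\<close> is convolution with respect to addition on \<open>'a\<close>. Writing the
  composition of permutations also as \<open>+\<close> therefore makes \<open>nat perm \<Rightarrow>\<^sub>0 rat\<close> the rational group
  algebra of the group of finitary permutations of the natural numbers. The algebra of
  \<open>Sym n\<close> is the subalgebra of elements supported on \<open>Sym n\<close>.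
\<close>

instantiation Perm.perm :: (type) monoid_add
begin

definition zero_perm :: "'a perm" where
  "zero_perm = 1"

definition plus_perm :: "'a perm \<Rightarrow> 'a perm \<Rightarrow> 'a perm" where
  "plus_perm \<sigma> \<tau> = \<sigma> * \<tau>"

instance
  by standard (simp_all add: zero_perm_def plus_perm_def mult.assoc)

end

definition basis_elt :: "nat perm \<Rightarrow> (nat perm \<Rightarrow>\<^sub>0 rat)" where
  "basis_elt \<sigma> = Poly_Mapping.single \<sigma> 1"

lemma basis_elt_one: "basis_elt 1 = 1"
  by (simp add: basis_elt_def flip: zero_perm_def)

lemma basis_elt_mult: "basis_elt (\<sigma> * \<tau>) = basis_elt \<sigma> * basis_elt \<tau>"
  by (simp add: basis_elt_def mult_single plus_perm_def)


subsection \<open>Factorizations\<close>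

text \<open>
  A factorization is the list of its factors; its length and target are \<open>length\<close> and
  \<open>prod_list\<close>. Fixed points in \<open>{1..n}\<close> count as cycles of length 1.
\<close>

definition cycles_of :: "nat \<Rightarrow> nat perm \<Rightarrow> nat set set" where
  "cycles_of n \<sigma> = Perm.orbit \<sigma> ` {1..n}"

definition num_cycles :: "nat \<Rightarrow> nat perm \<Rightarrow> nat" where
  "num_cycles n \<sigma> = card (cycles_of n \<sigma>)"

definition num_j_cycles :: "nat \<Rightarrow> nat \<Rightarrow> nat perm list \<Rightarrow> nat" where
  "num_j_cycles n j f = (\<Sum>\<sigma>\<leftarrow>f. card {C \<in> cycles_of n \<sigma>. card C = j})"

definition depth :: "nat \<Rightarrow> nat perm list \<Rightarrow> nat" where
  "depth n f = (\<Sum>j = 1..n. (j - 1) * num_j_cycles n j f)"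

inductive_set generated_subgroup :: "nat perm set \<Rightarrow> nat perm set" for A where
  one: "1 \<in> generated_subgroup A"
| gen: "\<sigma> \<in> A \<Longrightarrow> \<sigma> \<in> generated_subgroup A"
| mult: "\<sigma> \<in> generated_subgroup A \<Longrightarrow> \<tau> \<in> generated_subgroup A \<Longrightarrow> \<sigma> * \<tau> \<in> generated_subgroup A"
| inv: "\<sigma> \<in> generated_subgroup A \<Longrightarrow> inverse \<sigma> \<in> generated_subgroup A"

definition transitive_factorization :: "nat \<Rightarrow> nat perm list \<Rightarrow> bool" where
  "transitive_factorization n f \<longleftrightarrow>
     (\<forall>x\<in>{1..n}. \<forall>y\<in>{1..n}. \<exists>\<sigma>\<in>generated_subgroup (set f). Perm.apply \<sigma> x = y)"

definition transitive_of_genus :: "nat \<Rightarrow> nat \<Rightarrow> nat perm list \<Rightarrow> bool" where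
  "transitive_of_genus n g f \<longleftrightarrow> transitive_factorization n f \<and>
     int (depth n f) = int n + int (num_cycles n (prod_list f)) - 2 + 2 * int g"

definition monotone_factorizations :: "nat \<Rightarrow> nat perm list set" where
  "monotone_factorizations n =
     {map (\<lambda>(a, b). Perm.swap a b) ps | ps.
        (\<forall>(a, b)\<in>set ps. 1 \<le> a \<and> a < b \<and> b \<le> n) \<and> sorted (map snd ps)}"

definition nontrivial_cycle :: "nat perm \<Rightarrow> bool" where
  "nontrivial_cycle \<sigma> \<longleftrightarrow> (\<exists>xs. distinct xs \<and> length xs \<ge> 2 \<and> \<sigma> = Perm.cycle xs)"

definition cycle_factorizations :: "nat \<Rightarrow> nat perm list set" where
  "cycle_factorizations n = {f. set f \<subseteq> Sym n \<and> (\<forall>\<sigma>\<in>set f. nontrivial_cycle \<sigma>)}"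


subsection \<open>Inequivalent factorizations\<close>

definition commutation_step :: "(nat perm list \<times> nat perm list) set" where
  "commutation_step =
     {(xs @ [\<sigma>, \<tau>] @ ys, xs @ [\<tau>, \<sigma>] @ ys) | xs ys \<sigma> \<tau>. affected \<sigma> \<inter> affected \<tau> = {}}"

definition commutation_equiv :: "(nat perm list \<times> nat perm list) set" where
  "commutation_equiv = commutation_step\<^sup>*"

definition inequivalent_factorizations :: "nat \<Rightarrow> nat perm list set set" where
  "inequivalent_factorizations n = cycle_factorizations n // commutation_equiv"

definition inequivalent_factorizations_of_genus :: "nat \<Rightarrow> nat \<Rightarrow> nat perm list set set" where
  "inequivalent_factorizations_of_genus n g =
     {f \<in> cycle_factorizations n. transitive_of_genus n g f} // commutation_equiv"

text \<open>
  The common value of a function on an equivalence class. The lemmas below show that the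
  target, length and depth are indeed constant on classes.
\<close>

definition on_class :: "(nat perm list \<Rightarrow> 'b) \<Rightarrow> nat perm list set \<Rightarrow> 'b" where
  "on_class F c = the_elem (F ` c)"

lemma sym_commutation_step: "sym commutation_step"
proof (rule symI)
  fix f g assume "(f, g) \<in> commutation_step"
  then obtain xs ys \<sigma> \<tau> where "f = xs @ [\<sigma>, \<tau>] @ ys" "g = xs @ [\<tau>, \<sigma>] @ ys"
    "affected \<tau> \<inter> affected \<sigma> = {}"
    unfolding commutation_step_def by blast
  then show "(g, f) \<in> commutation_step"
    unfolding commutation_step_def by blast
qed

lemma equiv_commutation_equiv: "equiv UNIV commutation_equiv"
  unfolding commutation_equiv_def
  by (rule equivI) (simp_all add: refl_rtrancl sym_rtrancl sym_commutation_step trans_rtrancl)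

lemma commutation_equiv_invariant:
  assumes "(f, f') \<in> commutation_equiv"
  shows "prod_list f = prod_list f'" "mset f = mset f'"
proof -
  have "prod_list f = prod_list f' \<and> mset f = mset f'"
    using assms unfolding commutation_equiv_def
  proof (induction rule: rtrancl_induct)
    case (step g h)
    then obtain xs ys \<sigma> \<tau> where gh: "g = xs @ [\<sigma>, \<tau>] @ ys" "h = xs @ [\<tau>, \<sigma>] @ ys"
      "affected \<sigma> \<inter> affected \<tau> = {}"
      unfolding commutation_step_def by auto
    have "\<sigma> * \<tau> = \<tau> * \<sigma>"
      using gh(3) by (simp add: perm_mult_commute)
    then have "\<sigma> * (\<tau> * prod_list ys) = \<tau> * (\<sigma> * prod_list ys)"
      by (simp flip: mult.assoc)
    then show ?case
      using step gh by simp
  qed simp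
  then show "prod_list f = prod_list f'" "mset f = mset f'"
    by auto
qed

lemma depth_mset_cong:
  assumes "mset f = mset f'"
  shows "depth n f = depth n f'"
proof -
  have "num_j_cycles n j f = num_j_cycles n j f'" for j
    unfolding num_j_cycles_def sum_mset_sum_list[symmetric] mset_map assms ..
  then show ?thesis
    by (simp add: depth_def)
qed

lemma on_class_eqI:
  assumes "f \<in> c" "\<And>f'. f' \<in> c \<Longrightarrow> F f = F f'"
  shows "on_class F c = F f"
proof -
  have "F ` c = {F f}"
    using assms by (metis (no_types, lifting) image_cong image_constant)
  then show ?thesis
    by (simp add: on_class_def)
qed

lemma on_class_eq:
  assumes "c \<in> X // commutation_equiv" "f \<in> c"
  shows "on_class prod_list c = prod_list f"
    "on_class length c = length f"
    "on_class (depth n) c = depth n f"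
proof -
  have rel: "(f, f') \<in> commutation_equiv" if "f' \<in> c" for f'
  proof -
    obtain x where "c = commutation_equiv `` {x}"
      using assms(1) by (rule quotientE)
    then have x: "(x, f) \<in> commutation_equiv" "(x, f') \<in> commutation_equiv"
      using assms(2) that by auto
    show ?thesis
      using equiv_commutation_equiv x unfolding equiv_def sym_def by (blast dest: transD)
  qed
  show "on_class prod_list c = prod_list f"
    by (rule on_class_eqI[OF assms(2)]) (rule commutation_equiv_invariant(1)[OF rel])
  show "on_class length c = length f"
    by (rule on_class_eqI[OF assms(2)])
      (rule mset_eq_length[OF commutation_equiv_invariant(2)[OF rel]])
  show "on_class (depth n) c = depth n f"
    by (rule on_class_eqI[OF assms(2)])
      (rule depth_mset_cong[OF commutation_equiv_invariant(2)[OF rel]])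
qed


subsection \<open>The summands of the generating series\<close>

text \<open>
  Series over factorizations are unordered sums for the library's topology on \<open>fps\<close>, i.e. the
  adic topology of the variable \<open>fps_X\<close>.
\<close>

definition monotone_term :: "nat perm list \<Rightarrow> (nat perm \<Rightarrow>\<^sub>0 rat) fps" where
  "monotone_term f = fps_const (basis_elt (prod_list f)) * fps_X ^ length f"

definition inequivalent_term :: "nat \<Rightarrow> nat perm list set \<Rightarrow> (nat perm \<Rightarrow>\<^sub>0 rat) fps" where
  "inequivalent_term n c =
     fps_const (basis_elt (on_class prod_list c)) * (- 1) ^ on_class length c
       * (- fps_X) ^ on_class (depth n) c"

end

theory Submission
  imports Defs
begin

text \<open>
  For an equivalence relation \<open>R\<close> consider only factors that move points within \<open>R\<close>-classes, and let
  \<open>A = (\<Sum>\<sigma>. (-u)\<^bsup>d(\<sigma>)\<^esup> \<sigma>)\<close> over the permutations with this property. Both series are inverses of \<open>A\<close>.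

  Monotone factorizations: with \<open>J\<^sub>b\<close> the sum of the admissible \<open>(a b)\<close>, \<open>a < b\<close>, the last factor of a
  monotone factorization gives \<open>M\<^sub>b (1 - u J\<^sub>b) = M\<^sub>b\<^sub>-\<^sub>1\<close>, while removing the point \<open>b\<close> from a permutation
  gives \<open>A\<^sub>b = (1 - u J\<^sub>b) A\<^sub>b\<^sub>-\<^sub>1\<close>; hence \<open>M A = 1\<close> telescopes.

  Inequivalent cycle factorizations are the elements of a Cartier--Foata monoid, and a permutation is
  a set of disjoint cycles. Moving a cycle between \<open>\<sigma>\<close> and the front of a factorization \<open>f\<close> is a
  sign-reversing involution on the pairs \<open>(\<sigma>, f)\<close> other than \<open>(1, [])\<close>, so \<open>A I = 1\<close>.

  Thus \<open>M = I\<close> for every \<open>R\<close>, and Moebius inversion over \<open>R\<close> isolates the factorizations whose orbit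
  relation is exactly \<open>R\<close>, in particular the transitive ones. The genus of a transitive factorization
  is a function of its target and its depth, i.e. of the coefficient in which it is counted.
\<close>

unbundle permutation_syntax

subsection \<open>Cycles and depth of permutations\<close>

text \<open>The contribution of a single factor to the depth, free of \<open>n\<close>: fixed points
  would only add orbits of size 1, whose summand is 0.\<close>

definition perm_depth :: "'a perm \<Rightarrow> nat" where
  "perm_depth \<sigma> = (\<Sum>C\<in>Perm.orbit \<sigma> ` affected \<sigma>. card C - 1)"

lemma orbit_subset_closed:
  assumes "x \<in> S" "\<And>y. y \<in> S \<Longrightarrow> \<sigma> \<langle>$\<rangle> y \<in> S"
  shows "Perm.orbit \<sigma> x \<subseteq> S"
proof -
  have "(\<sigma> ^ k) \<langle>$\<rangle> x \<in> S" for k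
    by (induction k) (auto simp: apply_times assms)
  then show ?thesis
    by (auto simp: Perm.orbit_def)
qed

lemma orbit_eq_on:
  assumes "\<And>y. y \<in> Perm.orbit \<sigma> x \<Longrightarrow> \<tau> \<langle>$\<rangle> y = \<sigma> \<langle>$\<rangle> y"
  shows "Perm.orbit \<tau> x = Perm.orbit \<sigma> x"
proof -
  have "(\<tau> ^ k) \<langle>$\<rangle> x = (\<sigma> ^ k) \<langle>$\<rangle> x" for k
    by (induction k) (auto simp: apply_times assms)
  then show ?thesis
    by (auto simp: Perm.orbit_def)
qed

lemma apply_in_orbit:
  assumes "y \<in> Perm.orbit \<sigma> x"
  shows "\<sigma> \<langle>$\<rangle> y \<in> Perm.orbit \<sigma> x"
  using assms by (metis apply_self_in_orbit orbit_equiv)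

lemma orbit_sym: "y \<in> Perm.orbit \<sigma> x \<longleftrightarrow> x \<in> Perm.orbit \<sigma> y"
  by (metis in_orbit_self orbit_equiv)

text \<open>Multiplying by \<open>\<langle>a \<leftrightarrow> b\<rangle>\<close> inserts the fixed point \<open>b\<close> after \<open>a\<close> into the cycle of \<open>a\<close>.\<close>

lemma orbit_times_swap:
  assumes b: "b \<notin> affected \<tau>" and ab: "a \<noteq> b"
  shows "x \<in> insert b (Perm.orbit \<tau> a) \<Longrightarrow>
      Perm.orbit (\<tau> * \<langle>a \<leftrightarrow> b\<rangle>) x = insert b (Perm.orbit \<tau> a)"
    and "x \<notin> insert b (Perm.orbit \<tau> a) \<Longrightarrow>
      Perm.orbit (\<tau> * \<langle>a \<leftrightarrow> b\<rangle>) x = Perm.orbit \<tau> x"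
proof -
  let ?\<sigma> = "\<tau> * \<langle>a \<leftrightarrow> b\<rangle>"
  let ?S = "insert b (Perm.orbit \<tau> a)"
  have \<tau>b: "\<tau> \<langle>$\<rangle> b = b"
    using b by (simp add: in_affected)
  have app: "?\<sigma> \<langle>$\<rangle> y = (if y = a then b else if y = b then \<tau> \<langle>$\<rangle> a else \<tau> \<langle>$\<rangle> y)" for y
    using ab \<tau>b by (auto simp: apply_times)
  have b_in: "b \<in> Perm.orbit ?\<sigma> a"
    by (metis app apply_self_in_orbit)
  have \<tau>a: "\<tau> \<langle>$\<rangle> a \<in> Perm.orbit ?\<sigma> a"
    using apply_in_orbit[OF b_in] app ab by auto
  \<comment> \<open>The orbit of \<open>a\<close> under the product is closed under
    \<open>\<tau>\<close>, so it contains the whole \<open>\<tau>\<close>-orbit of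
    \<open>a\<close>.\<close>
  have step: "\<tau> \<langle>$\<rangle> y \<in> Perm.orbit ?\<sigma> a" if "y \<in> Perm.orbit ?\<sigma> a" for y
    using apply_in_orbit[OF that] app[of y] \<tau>a \<tau>b b_in by (cases "y = a"; cases "y = b") auto
  have "?S \<subseteq> Perm.orbit ?\<sigma> a"
    using b_in orbit_subset_closed[of a "Perm.orbit ?\<sigma> a" \<tau>] step by auto
  moreover have "Perm.orbit ?\<sigma> a \<subseteq> ?S"
  proof (rule orbit_subset_closed)
    fix y assume "y \<in> ?S"
    then show "?\<sigma> \<langle>$\<rangle> y \<in> ?S"
      using app[of y] by (auto simp: apply_in_orbit)
  qed simp
  ultimately have eq: "Perm.orbit ?\<sigma> a = ?S"
    by auto
  show "Perm.orbit ?\<sigma> x = ?S" if "x \<in> ?S"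
    using that eq orbit_equiv by metis
  \<comment> \<open>The two permutations differ only at \<open>a\<close> and \<open>b\<close>, and
    the \<open>\<tau>\<close>-orbit of \<open>x\<close> avoids both.\<close>
  show "Perm.orbit ?\<sigma> x = Perm.orbit \<tau> x" if x: "x \<notin> ?S"
  proof (rule orbit_eq_on)
    fix y assume y: "y \<in> Perm.orbit \<tau> x"
    have "y \<noteq> a"
      using x y orbit_sym by fastforce
    moreover have "y \<noteq> b"
    proof
      assume "y = b"
      then have "x \<in> Perm.orbit \<tau> b"
        using y orbit_sym by fastforce
      then show False
        using x b by (simp add: not_in_affected_iff_orbit_eq_singleton)
    qed
    ultimately show "?\<sigma> \<langle>$\<rangle> y = \<tau> \<langle>$\<rangle> y"
      by (simp add: app)
  qed
qed

lemma affected_times_swap: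
  assumes "b \<notin> affected \<tau>" "a \<noteq> b"
  shows "affected (\<tau> * \<langle>a \<leftrightarrow> b\<rangle>) = affected \<tau> \<union> {a, b}"
proof -
  have *: "\<tau> \<langle>$\<rangle> b = b"
    using assms by (simp add: in_affected)
  show ?thesis
  proof (rule set_eqI)
    fix x show "x \<in> affected (\<tau> * \<langle>a \<leftrightarrow> b\<rangle>) \<longleftrightarrow> x \<in> affected \<tau> \<union> {a, b}"
    proof (cases "x = a \<or> x = b")
      case True
      have "\<tau> \<langle>$\<rangle> a \<noteq> b" using * assms(2) by (metis apply_inj)
      with True show ?thesis
        using * assms(2) by (auto simp: in_affected apply_times)
    qed (auto simp: in_affected apply_times)
  qed
qed

section \<open>Cycles given by lists, and the cycles of a permutation\<close>

lemma affected_cycle_subset: "affected \<langle>xs\<rangle> \<subseteq> set xs"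
proof (induction xs rule: cycle.induct)
  case (3 a b as)
  have "affected \<langle>a \<leftrightarrow> b\<rangle> \<subseteq> {a, b}"
    by (cases "a = b") (auto simp: affected_swap)
  then have "affected \<langle>a # as\<rangle> \<union> affected \<langle>a \<leftrightarrow> b\<rangle> \<subseteq> set (a # b # as)"
    using 3 by auto
  then show ?case
    unfolding cycle.simps by (rule subset_trans[OF affected_times])
qed auto

text \<open>The recursion of \<open>cycle\<close> multiplies \<open>\<langle>a # as\<rangle>\<close>
  on the right by \<open>\<langle>a \<leftrightarrow> b\<rangle>\<close>, so each step inserts one
  new point into the orbit of \<open>a\<close>.\<close>

lemma orbit_cycle:
  assumes "distinct xs" "x \<in> set xs"
  shows "Perm.orbit \<langle>xs\<rangle> x = set xs"
  using assms
proof (induction xs arbitrary: x rule: cycle.induct)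
  case (3 a b as)
  have "b \<notin> affected \<langle>a # as\<rangle>" "a \<noteq> b"
    using affected_cycle_subset[of "a # as"] "3.prems" by auto
  moreover have "Perm.orbit \<langle>a # as\<rangle> a = set (a # as)"
    using 3 by auto
  ultimately show ?case
    using orbit_times_swap(1)[of b "\<langle>a # as\<rangle>" a x] 3 by auto
qed auto

text \<open>Every entry of a list of length at least 2 has an orbit with at least two points and is
  therefore moved; so the support is exactly the set of entries, which is a single orbit.\<close>

lemma nontrivial_cycle_orbit:
  assumes c: "nontrivial_cycle c" and x: "x \<in> affected c"
  shows "Perm.orbit c x = affected c"
proof -
  obtain xs where xs: "distinct xs" "length xs \<ge> 2" "c = \<langle>xs\<rangle>"
    using c unfolding nontrivial_cycle_def by blast
  have in_set: "set xs \<subseteq> affected c"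
  proof
    fix y assume "y \<in> set xs"
    then have "card (Perm.orbit c y) \<ge> 2"
      using xs orbit_cycle[of xs y] by (simp add: distinct_card del: card_orbit_eq)
    then show "y \<in> affected c"
      by (simp add: order_greater_eq_two_iff)
  qed
  show ?thesis
    using in_set affected_cycle_subset[of xs] x xs orbit_cycle[of xs x] by auto
qed

lemma nontrivial_cycle_affected_nonempty:
  assumes "nontrivial_cycle c"
  shows "affected c \<noteq> {}"
proof -
  obtain xs where xs: "distinct xs" "length xs \<ge> 2" "c = \<langle>xs\<rangle>"
    using assms unfolding nontrivial_cycle_def by blast
  then obtain y where y: "y \<in> set xs"
    by (cases xs) auto
  then have "card (Perm.orbit c y) \<ge> 2"
    using xs orbit_cycle[of xs y] by (simp add: distinct_card del: card_orbit_eq)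
  then show ?thesis
    using order_greater_eq_two_iff[of c y] by auto
qed

text \<open>Induction on the size of the support. With \<open>b\<close> the image of
  \<open>a\<close>, the product \<open>\<sigma> * \<langle>a \<leftrightarrow> b\<rangle>\<close>
  fixes \<open>b\<close> and moves fewer points; writing \<open>b\<close> directly after
  \<open>a\<close> in the cycle found for it gives the cycle of \<open>\<sigma>\<close>.\<close>

lemma ex_cycle_of_orbit:
  "\<exists>as. distinct (a # as) \<and> set (a # as) = Perm.orbit \<sigma> a \<and>
     (\<forall>x\<in>Perm.orbit \<sigma> a. \<langle>a # as\<rangle> \<langle>$\<rangle> x = \<sigma> \<langle>$\<rangle> x) \<and> affected \<langle>a # as\<rangle> \<subseteq> set (a # as)"
proof (induction "card (affected \<sigma>)" arbitrary: \<sigma> rule: less_induct)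
  case less
  show ?case
  proof (cases "\<sigma> \<langle>$\<rangle> a = a")
    case True
    then have "Perm.orbit \<sigma> a = {a}"
      using not_in_affected_iff_orbit_eq_singleton[of a \<sigma>] by (simp add: in_affected)
    with True show ?thesis
      by (intro exI[of _ "[]"]) auto
  next
    case False
    define b where "b = \<sigma> \<langle>$\<rangle> a"
    define \<tau> where "\<tau> = \<sigma> * \<langle>a \<leftrightarrow> b\<rangle>"
    have ab: "a \<noteq> b" using False b_def by auto
    have \<sigma>: "\<sigma> = \<tau> * \<langle>a \<leftrightarrow> b\<rangle>"
      by (simp add: \<tau>_def mult.assoc)
    have b: "b \<notin> affected \<tau>"
      by (simp add: in_affected \<tau>_def apply_times b_def)
    have "b \<in> affected \<sigma>"
      using affected_times_swap[OF b ab] \<sigma> by simp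
    then have "affected \<tau> \<subset> affected \<sigma>"
      using affected_times_swap[OF b ab] \<sigma> b by blast
    then have "card (affected \<tau>) < card (affected \<sigma>)"
      by (simp add: psubset_card_mono)
    from less[OF this] obtain as where as: "distinct (a # as)"
      "set (a # as) = Perm.orbit \<tau> a"
      "\<And>x. x \<in> Perm.orbit \<tau> a \<Longrightarrow> \<langle>a # as\<rangle> \<langle>$\<rangle> x = \<tau> \<langle>$\<rangle> x"
      "affected \<langle>a # as\<rangle> \<subseteq> set (a # as)"
      by blast
    have "b \<notin> Perm.orbit \<tau> a"
      using b ab orbit_sym[of b \<tau> a] by (auto simp: not_in_affected_iff_orbit_eq_singleton)
    then have b_as: "b \<notin> set (a # as)" using as by simp
    have orb: "Perm.orbit \<sigma> a = insert b (Perm.orbit \<tau> a)"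
      using orbit_times_swap(1)[OF b ab, of a] \<sigma> by simp
    show ?thesis
    proof (intro exI[of _ "b # as"] conjI ballI)
      show "distinct (a # b # as)" using as b_as by auto
      show "set (a # b # as) = Perm.orbit \<sigma> a" using as orb by auto
      show "affected \<langle>a # b # as\<rangle> \<subseteq> set (a # b # as)"
        using affected_times[of "\<langle>a # as\<rangle>" "\<langle>a \<leftrightarrow> b\<rangle>"] affected_swap[OF ab] as(4)
        by (auto simp del: affected_times)
      fix x assume "x \<in> Perm.orbit \<sigma> a"
      then consider "x = a" | "x = b" | "x \<noteq> a" "x \<noteq> b" "x \<in> Perm.orbit \<tau> a"
        using orb by blast
      then show "\<langle>a # b # as\<rangle> \<langle>$\<rangle> x = \<sigma> \<langle>$\<rangle> x"
      proof cases
        case 1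
        have "b \<notin> affected \<langle>a # as\<rangle>" using as(4) b_as by blast
        then have "\<langle>a # as\<rangle> \<langle>$\<rangle> b = b" by (simp add: in_affected)
        with 1 show ?thesis by (simp add: apply_times b_def)
      next
        case 2
        then show ?thesis using as(3)[of a] \<sigma> by (simp add: apply_times)
      next
        case 3
        then show ?thesis using as(3)[of x] \<sigma> by (simp add: apply_times)
      qed
    qed
  qed
qed

text \<open>The factors of the disjoint cycle decomposition of \<open>\<sigma>\<close>. Agreement on
  the support of \<open>c\<close> already forces this support to be an orbit of
  \<open>\<sigma>\<close>.\<close>

definition perm_cycles :: "nat perm \<Rightarrow> nat perm set" where
  "perm_cycles \<sigma> = {c. nontrivial_cycle c \<and> (\<forall>x\<in>affected c. c \<langle>$\<rangle> x = \<sigma> \<langle>$\<rangle> x)}"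

lemma perm_cycles_nonempty:
  assumes "\<sigma> \<noteq> 1"
  shows "perm_cycles \<sigma> \<noteq> {}"
proof -
  obtain a where a: "a \<in> affected \<sigma>"
    using assms affected_empty_iff by blast
  obtain as where as: "distinct (a # as)" "set (a # as) = Perm.orbit \<sigma> a"
     "\<And>x. x\<in>Perm.orbit \<sigma> a \<Longrightarrow> \<langle>a # as\<rangle> \<langle>$\<rangle> x = \<sigma> \<langle>$\<rangle> x" "affected \<langle>a # as\<rangle> \<subseteq> set (a # as)"
    using ex_cycle_of_orbit[of a \<sigma>] by auto
  have "as \<noteq> []"
    using a as(2) not_in_affected_iff_orbit_eq_singleton[of a \<sigma>] by auto
  then have "length (a # as) \<ge> 2"
    by (cases as) auto
  then have "\<langle>a # as\<rangle> \<in> perm_cycles \<sigma>"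
    using as unfolding perm_cycles_def nontrivial_cycle_def by blast
  then show ?thesis by auto
qed

text \<open>If both cycles move \<open>x\<close>, both supports equal the
  \<open>\<sigma>\<close>-orbit of \<open>x\<close>, and on it both agree with
  \<open>\<sigma>\<close>.\<close>

lemma perm_cycles_eq_or_disjoint:
  assumes "c \<in> perm_cycles \<sigma>" "d \<in> perm_cycles \<sigma>"
  shows "c = d \<or> affected c \<inter> affected d = {}"
proof (rule disjCI)
  assume "affected c \<inter> affected d \<noteq> {}"
  then obtain x where x: "x \<in> affected c" "x \<in> affected d" by auto
  have orb: "Perm.orbit \<sigma> x = affected e" if "e \<in> perm_cycles \<sigma>" "x \<in> affected e" for e
    using that orbit_eq_on[of e x \<sigma>] nontrivial_cycle_orbit[of e x] unfolding perm_cycles_def by auto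
  have aff: "affected c = affected d"
    using orb[OF assms(1)] orb[OF assms(2)] x by auto
  show "c = d"
  proof (rule perm_eqI)
    fix y show "c \<langle>$\<rangle> y = d \<langle>$\<rangle> y"
      using assms aff in_affected[of y c] in_affected[of y d] unfolding perm_cycles_def
      by (cases "y \<in> affected c") auto
  qed
qed

lemma affected_perm_cycle:
  assumes "c \<in> perm_cycles \<sigma>"
  shows "affected c \<subseteq> affected \<sigma>"
  using assms by (auto simp: perm_cycles_def in_affected)

lemma affected_inverse_mult_perm_cycle:
  assumes "c \<in> perm_cycles \<sigma>"
  shows "affected c \<inter> affected (inverse c * \<sigma>) = {}"
proof -
  have "(inverse c * \<sigma>) \<langle>$\<rangle> x = x" if "x \<in> affected c" for x
  proof -
    have "\<sigma> \<langle>$\<rangle> x = c \<langle>$\<rangle> x" using assms that by (auto simp: perm_cycles_def)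
    then have "(inverse c * \<sigma>) \<langle>$\<rangle> x = (inverse c * c) \<langle>$\<rangle> x"
      by (simp only: apply_times comp_apply)
    then show ?thesis by simp
  qed
  then show ?thesis by (auto simp: in_affected)
qed

lemma apply_mult_disjoint:
  assumes "affected c \<inter> affected \<sigma> = {}"
  shows "(c * \<sigma>) \<langle>$\<rangle> x = (if x \<in> affected c then c \<langle>$\<rangle> x else \<sigma> \<langle>$\<rangle> x)"
proof (cases "x \<in> affected c")
  case True
  then have "\<sigma> \<langle>$\<rangle> x = x" using assms by (auto simp: in_affected)
  with True show ?thesis by (simp add: apply_times)
next
  case False
  have "\<sigma> \<langle>$\<rangle> x \<notin> affected c"
  proof
    assume *: "\<sigma> \<langle>$\<rangle> x \<in> affected c"
    then have "x \<notin> affected \<sigma>" using assms by auto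
    then show False using * False by (simp add: in_affected)
  qed
  with False show ?thesis by (simp add: apply_times in_affected)
qed

lemma affected_mult_disjoint:
  assumes "affected c \<inter> affected \<sigma> = {}"
  shows "affected (c * \<sigma>) = affected c \<union> affected \<sigma>"
  using apply_mult_disjoint[OF assms] by (auto simp: in_affected split: if_splits)

text \<open>The factor \<open>c\<close> is itself a cycle of the product, so any other cycle of the
  product is disjoint from \<open>c\<close>; away from \<open>c\<close> the product and
  \<open>\<sigma>\<close> coincide.\<close>

lemma perm_cycles_mult_disjoint:
  assumes c: "nontrivial_cycle c" and disj: "affected c \<inter> affected \<sigma> = {}"
  shows "perm_cycles (c * \<sigma>) = insert c (perm_cycles \<sigma>)"
proof (intro equalityI subsetI)
  have c_in: "c \<in> perm_cycles (c * \<sigma>)"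
    using c by (simp add: perm_cycles_def apply_mult_disjoint[OF disj])
  fix d
  {
    assume d: "d \<in> insert c (perm_cycles \<sigma>)"
    show "d \<in> perm_cycles (c * \<sigma>)"
    proof (cases "d = c")
      case False
      then have "d \<in> perm_cycles \<sigma>" using d by simp
      moreover have "affected d \<inter> affected c = {}"
        using affected_perm_cycle[OF calculation] disj by auto
      ultimately show ?thesis
        by (auto simp: perm_cycles_def apply_mult_disjoint[OF disj])
    qed (simp add: c_in)
  next
    assume d: "d \<in> perm_cycles (c * \<sigma>)"
    then consider "d = c" | "affected d \<inter> affected c = {}"
      using perm_cycles_eq_or_disjoint[OF d c_in] by auto
    then show "d \<in> insert c (perm_cycles \<sigma>)"
    proof cases
      case 2
      with d show ?thesis
        by (auto simp: perm_cycles_def apply_mult_disjoint[OF disj] disjoint_iff)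
    qed simp
  }
qed

section \<open>Depth under products\<close>

lemma perm_depth_superset:
  assumes "finite A" "affected \<sigma> \<subseteq> A"
  shows "perm_depth \<sigma> = (\<Sum>C\<in>Perm.orbit \<sigma> ` A. card C - 1)"
  unfolding perm_depth_def
proof (rule sum.mono_neutral_left)
  show "\<forall>C\<in>Perm.orbit \<sigma> ` A - Perm.orbit \<sigma> ` affected \<sigma>. card C - 1 = 0"
  proof
    fix C assume "C \<in> Perm.orbit \<sigma> ` A - Perm.orbit \<sigma> ` affected \<sigma>"
    then obtain x where "C = Perm.orbit \<sigma> x" "x \<notin> affected \<sigma>"
      by blast
    then show "card C - 1 = 0"
      using not_in_affected_iff_orbit_eq_singleton[of x \<sigma>] by (simp del: card_orbit_eq)
  qed
qed (use assms in auto)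

text \<open>On each of the two supports the orbits of the product are those of the corresponding
  factor, and no orbit occurs in both families.\<close>

lemma perm_depth_mult_disjoint:
  assumes disj: "affected c \<inter> affected \<sigma> = {}"
  shows "perm_depth (c * \<sigma>) = perm_depth c + perm_depth \<sigma>"
proof -
  note app = apply_mult_disjoint[OF disj]
  have 1: "Perm.orbit (c * \<sigma>) x = Perm.orbit c x" if "x \<in> affected c" for x
    by (rule orbit_eq_on) (use that orbit_subset_eq_affected[of x c] in \<open>auto simp: app\<close>)
  have 2: "Perm.orbit (c * \<sigma>) x = Perm.orbit \<sigma> x" if "x \<in> affected \<sigma>" for x
    by (rule orbit_eq_on) (use that orbit_subset_eq_affected[of x \<sigma>] disj in \<open>auto simp: app\<close>)
  have img: "Perm.orbit (c * \<sigma>) ` affected (c * \<sigma>) = Perm.orbit c ` affected c \<union> Perm.orbit \<sigma> ` affected \<sigma>"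
    unfolding affected_mult_disjoint[OF disj] image_Un by (intro arg_cong2[where f = "(\<union>)"] image_cong) (auto simp: 1 2)
  have "Perm.orbit c ` affected c \<inter> Perm.orbit \<sigma> ` affected \<sigma> = {}"
  proof (rule ccontr)
    assume "\<not> ?thesis"
    then obtain x y where "x \<in> affected c" "y \<in> affected \<sigma>" "Perm.orbit c x = Perm.orbit \<sigma> y"
      by auto
    then show False
      using disj orbit_subset_eq_affected[of x c] orbit_subset_eq_affected[of y \<sigma>] in_orbit_self[of x c]
      by blast
  qed
  then show ?thesis
    unfolding perm_depth_def img by (intro sum.union_disjoint) auto
qed

text \<open>The orbit of \<open>a\<close> and the singleton \<open>{b}\<close> merge and all other
  orbits stay. Merging an orbit of size \<open>m\<close> with a fixed point replaces the
  contribution \<open>m - 1\<close> by \<open>m\<close>.\<close>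

lemma perm_depth_times_swap:
  assumes b: "b \<notin> affected \<tau>" and ab: "a \<noteq> b"
  shows "perm_depth (\<tau> * \<langle>a \<leftrightarrow> b\<rangle>) = Suc (perm_depth \<tau>)"
proof -
  define \<sigma> where "\<sigma> = \<tau> * \<langle>a \<leftrightarrow> b\<rangle>"
  define A where "A = affected \<tau> \<union> {a, b}"
  define B where "B = A - insert b (Perm.orbit \<tau> a)"
  let ?S = "Perm.orbit \<tau> ` B"
  have b_orb: "Perm.orbit \<tau> b = {b}" "b \<notin> Perm.orbit \<tau> a"
    using b ab orbit_sym[of b \<tau> a] by (auto simp: not_in_affected_iff_orbit_eq_singleton)
  have "Perm.orbit \<tau> a \<subseteq> A"
    using orbit_subset_eq_affected[of a \<tau>] not_in_affected_iff_orbit_eq_singleton[of a \<tau>]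
    by (auto simp: A_def)
  then have A: "A = insert b (Perm.orbit \<tau> a) \<union> B"
    by (auto simp: B_def A_def)
  have fin: "finite A" "finite B" by (auto simp: A_def B_def)
  have img: "f ` A = f ` insert b (Perm.orbit \<tau> a) \<union> f ` B" for f :: "'a \<Rightarrow> 'a set"
    using A image_Un by metis
  have "Perm.orbit \<tau> ` Perm.orbit \<tau> a = {Perm.orbit \<tau> a}"
  proof (intro equalityI subsetI)
    show "C \<in> {Perm.orbit \<tau> a}" if "C \<in> Perm.orbit \<tau> ` Perm.orbit \<tau> a" for C
      using that orbit_equiv[of _ \<tau> a] by blast
    show "C \<in> Perm.orbit \<tau> ` Perm.orbit \<tau> a" if "C \<in> {Perm.orbit \<tau> a}" for C
      using that by (intro image_eqI[of _ _ a]) auto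
  qed
  then have img\<tau>: "Perm.orbit \<tau> ` A = {{b}, Perm.orbit \<tau> a} \<union> ?S"
    unfolding img image_insert b_orb by simp
  have "Perm.orbit \<sigma> ` insert b (Perm.orbit \<tau> a) = {insert b (Perm.orbit \<tau> a)}"
  proof (intro equalityI subsetI)
    show "C \<in> {insert b (Perm.orbit \<tau> a)}"
      if "C \<in> Perm.orbit \<sigma> ` insert b (Perm.orbit \<tau> a)" for C
      using that orbit_times_swap(1)[OF b ab, folded \<sigma>_def] by blast
    show "C \<in> Perm.orbit \<sigma> ` insert b (Perm.orbit \<tau> a)"
      if "C \<in> {insert b (Perm.orbit \<tau> a)}" for C
      using that orbit_times_swap(1)[OF b ab, of b, folded \<sigma>_def] by (intro image_eqI[of _ _ b]) auto
  qed
  moreover have "Perm.orbit \<sigma> ` B = ?S"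
    using orbit_times_swap(2)[OF b ab, folded \<sigma>_def] by (intro image_cong) (auto simp: B_def)
  ultimately have img\<sigma>: "Perm.orbit \<sigma> ` A = {insert b (Perm.orbit \<tau> a)} \<union> ?S"
    unfolding img by (rule arg_cong2)
  have nS: "C \<inter> insert b (Perm.orbit \<tau> a) = {}" "C \<noteq> {}" if C: "C \<in> ?S" for C
  proof -
    obtain x where x: "x \<in> B" "C = Perm.orbit \<tau> x" using C by auto
    have "y \<notin> insert b (Perm.orbit \<tau> a)" if "y \<in> C" for y
    proof
      assume "y \<in> insert b (Perm.orbit \<tau> a)"
      moreover have "x \<in> Perm.orbit \<tau> y" using that x orbit_sym by metis
      ultimately have "x \<in> insert b (Perm.orbit \<tau> a)"
        using b_orb orbit_equiv[of y \<tau> a] by auto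
      then show False using x by (auto simp: B_def)
    qed
    then show "C \<inter> insert b (Perm.orbit \<tau> a) = {}" by auto
    show "C \<noteq> {}" using x by simp
  qed
  have "perm_depth \<sigma> = (\<Sum>C\<in>{insert b (Perm.orbit \<tau> a)} \<union> ?S. card C - 1)"
    unfolding img\<sigma>[symmetric]
    by (rule perm_depth_superset) (use affected_times_swap[OF b ab] in \<open>auto simp: A_def \<sigma>_def\<close>)
  also have "\<dots> = card (Perm.orbit \<tau> a) + (\<Sum>C\<in>?S. card C - 1)"
    using nS fin b_orb by (subst sum.union_disjoint) (auto simp del: card_orbit_eq)
  finally have 1: "perm_depth \<sigma> = card (Perm.orbit \<tau> a) + (\<Sum>C\<in>?S. card C - 1)" .
  have "perm_depth \<tau> = (\<Sum>C\<in>{{b}, Perm.orbit \<tau> a} \<union> ?S. card C - 1)"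
    unfolding img\<tau>[symmetric] by (rule perm_depth_superset) (auto simp: A_def)
  also have "\<dots> = (\<Sum>C\<in>{{b}, Perm.orbit \<tau> a}. card C - 1) + (\<Sum>C\<in>?S. card C - 1)"
  proof (rule sum.union_disjoint)
    have "C \<noteq> {b}" "C \<noteq> Perm.orbit \<tau> a" if "C \<in> ?S" for C
      using nS[OF that] by blast+
    then show "{{b}, Perm.orbit \<tau> a} \<inter> ?S = {}" by blast
  qed (use fin in auto)
  also have "(\<Sum>C\<in>{{b}, Perm.orbit \<tau> a}. card C - 1) = card (Perm.orbit \<tau> a) - 1"
    using b_orb by (subst sum.insert) auto
  finally have 2: "perm_depth \<tau> = card (Perm.orbit \<tau> a) - 1 + (\<Sum>C\<in>?S. card C - 1)" .
  \<comment> \<open>Positivity makes the truncated subtraction in the second equation exact.\<close>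
  have "card (Perm.orbit \<tau> a) > 0" by simp
  with 1 2 show ?thesis unfolding \<sigma>_def by linarith
qed

text \<open>Conjugating \<open>\<langle>a \<leftrightarrow> b\<rangle>\<close> by
  \<open>\<tau>\<close> applies \<open>\<tau>\<close> to both points, and \<open>b\<close> is
  fixed.\<close>

lemma swap_times_fixed:
  assumes "b \<notin> affected \<tau>"
  shows "\<langle>\<tau> \<langle>$\<rangle> a \<leftrightarrow> b\<rangle> * \<tau> = \<tau> * \<langle>a \<leftrightarrow> b\<rangle>"
proof (rule perm_eqI)
  fix x
  have b: "\<tau> \<langle>$\<rangle> b = b" using assms by (simp add: in_affected)
  consider "x = a" | "x = b" | "x \<noteq> a" "x \<noteq> b" by auto
  then show "(\<langle>\<tau> \<langle>$\<rangle> a \<leftrightarrow> b\<rangle> * \<tau>) \<langle>$\<rangle> x = (\<tau> * \<langle>a \<leftrightarrow> b\<rangle>) \<langle>$\<rangle> x"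
  proof cases
    case 3
    then have "\<tau> \<langle>$\<rangle> x \<noteq> \<tau> \<langle>$\<rangle> a" "\<tau> \<langle>$\<rangle> x \<noteq> b"
      using apply_inj b by metis+
    with 3 show ?thesis by (simp add: apply_times)
  qed (simp_all add: apply_times b)
qed

lemma perm_depth_swap_times:
  assumes b: "b \<notin> affected \<tau>" and ab: "a \<noteq> b"
  shows "perm_depth (\<langle>a \<leftrightarrow> b\<rangle> * \<tau>) = Suc (perm_depth \<tau>)"
proof -
  \<comment> \<open>The preimage of \<open>a\<close> turns left multiplication by
    \<open>\<langle>a \<leftrightarrow> b\<rangle>\<close> into right multiplication by
    \<open>\<langle>a' \<leftrightarrow> b\<rangle>\<close>.\<close>
  define a' where "a' = inverse \<tau> \<langle>$\<rangle> a"
  have a: "\<tau> \<langle>$\<rangle> a' = a"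
    by (simp add: a'_def apply_sequence)
  then have "a' \<noteq> b"
    using ab b by (auto simp: in_affected)
  then show ?thesis
    using perm_depth_times_swap[OF b, of a'] swap_times_fixed[OF b, of a'] a by simp
qed

lemma perm_depth_one [simp]: "perm_depth 1 = 0"
  by (simp add: perm_depth_def)

lemma perm_depth_pos:
  assumes "\<sigma> \<noteq> 1"
  shows "perm_depth \<sigma> > 0"
proof -
  obtain a where a: "a \<in> affected \<sigma>"
    using assms affected_empty_iff by blast
  have "card (Perm.orbit \<sigma> a) - 1 \<le> perm_depth \<sigma>"
    unfolding perm_depth_def by (rule member_le_sum) (use a in auto)
  moreover have "card (Perm.orbit \<sigma> a) \<ge> 2"
    using a by (simp add: order_greater_eq_two_iff)
  ultimately show ?thesis by linarith
qed

text \<open>Grouping the cycles of each factor by their length, which lies between 1 and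
  \<open>n\<close>, identifies the weighted cycle counts with sums over orbits.\<close>

lemma depth_eq_sum_perm_depth:
  assumes "set f \<subseteq> Sym n"
  shows "depth n f = (\<Sum>\<sigma>\<leftarrow>f. perm_depth \<sigma>)"
proof -
  have single: "(\<Sum>j = 1..n. (j - 1) * card {C \<in> cycles_of n \<sigma>. card C = j}) = perm_depth \<sigma>"
    if "\<sigma> \<in> Sym n" for \<sigma>
  proof -
    have aff: "affected \<sigma> \<subseteq> {1..n}" using that by (simp add: Sym_def)
    have card: "card C \<in> {1..n}" if "C \<in> cycles_of n \<sigma>" for C
    proof -
      obtain x where x: "x \<in> {1..n}" "C = Perm.orbit \<sigma> x"
        using \<open>C \<in> cycles_of n \<sigma>\<close> unfolding cycles_of_def by blast
      then have "C \<subseteq> {1..n}"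
        using aff orbit_subset_eq_affected[of x \<sigma>] not_in_affected_iff_orbit_eq_singleton[of x \<sigma>]
        by (cases "x \<in> affected \<sigma>") auto
      then have "card C \<le> n" using card_mono[of "{1..n}" C] by simp
      moreover have "card C > 0" using x by simp
      ultimately show ?thesis by simp
    qed
    have "perm_depth \<sigma> = (\<Sum>C\<in>cycles_of n \<sigma>. card C - 1)"
      unfolding cycles_of_def by (rule perm_depth_superset) (use aff in auto)
    also have "\<dots> = (\<Sum>j = 1..n. \<Sum>C\<in>{C \<in> cycles_of n \<sigma>. card C = j}. card C - 1)"
    proof (rule sum.group[symmetric])
      show "card ` cycles_of n \<sigma> \<subseteq> {1..n}"
        using card by blast
    qed (auto simp: cycles_of_def)
    also have "\<dots> = (\<Sum>j = 1..n. (j - 1) * card {C \<in> cycles_of n \<sigma>. card C = j})"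
      by (rule sum.cong) (auto simp: mult.commute)
    finally show ?thesis ..
  qed
  show ?thesis
    using assms
  proof (induction f)
    case Nil
    then show ?case by (simp add: depth_def num_j_cycles_def)
  next
    case (Cons \<sigma> f)
    have "depth n (\<sigma> # f) = (\<Sum>j = 1..n. (j - 1) * card {C \<in> cycles_of n \<sigma>. card C = j}) + depth n f"
      by (simp add: depth_def num_j_cycles_def add_mult_distrib2 sum.distrib)
    with Cons single[of \<sigma>] show ?case by simp
  qed
qed


subsection \<open>Generating series of weighted sets\<close>

text \<open>The formal sum of \<open>v x\<close> times the variable to the power \<open>d x\<close>.
  Over an infinite level the inner sum would be 0 by convention, hence the accompanying predicate
  \<open>finite_levels\<close>.\<close>

definition gen_series :: "'x set \<Rightarrow> ('x \<Rightarrow> nat) \<Rightarrow> ('x \<Rightarrow> 'b) \<Rightarrow> ('b::comm_monoid_add) fps" where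
  "gen_series S d v = Abs_fps (\<lambda>k. \<Sum>x | x \<in> S \<and> d x = k. v x)"

definition finite_levels :: "'x set \<Rightarrow> ('x \<Rightarrow> nat) \<Rightarrow> bool" where
  "finite_levels S d \<longleftrightarrow> (\<forall>k. finite {x \<in> S. d x = k})"

lemma gen_series_nth: "fps_nth (gen_series S d v) k = (\<Sum>x | x \<in> S \<and> d x = k. v x)"
  by (simp add: gen_series_def)

text \<open>The pairs of total weight \<open>k\<close> form a finite set, partitioned by the weight
  \<open>i\<close> of the first component into products of level \<open>i\<close> and level
  \<open>k - i\<close>.\<close>

lemma gen_series_mult:
  fixes v :: "'x \<Rightarrow> 'b::semiring_0"
  assumes "finite_levels S d" "finite_levels T e"
  shows "gen_series S d v * gen_series T e w =
    gen_series (S \<times> T) (\<lambda>(x, y). d x + e y) (\<lambda>(x, y). v x * w y)"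
proof (rule fps_ext)
  fix k
  let ?P = "{p \<in> S \<times> T. (case p of (x, y) \<Rightarrow> d x + e y) = k}"
  have slice: "{p \<in> ?P. d (fst p) = i} = {x \<in> S. d x = i} \<times> {y \<in> T. e y = k - i}" if "i \<in> {0..k}" for i
    using that by auto
  have "?P = (\<Union>i\<in>{0..k}. {p \<in> ?P. d (fst p) = i})"
    by auto
  also have "finite \<dots>"
    using assms by (intro finite_UN_I) (simp_all add: slice finite_levels_def del: mem_Collect_eq)
  finally have fin: "finite ?P" .
  have "fps_nth (gen_series S d v * gen_series T e w) k =
      (\<Sum>i=0..k. \<Sum>p\<in>{x \<in> S. d x = i} \<times> {y \<in> T. e y = k - i}. case p of (x, y) \<Rightarrow> v x * w y)"
    by (simp add: fps_mult_nth gen_series_nth sum_product sum.cartesian_product)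
  also have "\<dots> = (\<Sum>i=0..k. \<Sum>p\<in>{p \<in> ?P. d (fst p) = i}. case p of (x, y) \<Rightarrow> v x * w y)"
    using slice by (intro sum.cong) auto
  also have "\<dots> = (\<Sum>p\<in>?P. case p of (x, y) \<Rightarrow> v x * w y)"
    using fin by (intro sum.group) auto
  finally show "fps_nth (gen_series S d v * gen_series T e w) k =
      fps_nth (gen_series (S \<times> T) (\<lambda>(x, y). d x + e y) (\<lambda>(x, y). v x * w y)) k"
    by (simp add: gen_series_nth)
qed

lemma gen_series_image:
  assumes "inj_on h S" "\<And>x. x \<in> S \<Longrightarrow> e (h x) = d x" "\<And>x. x \<in> S \<Longrightarrow> w (h x) = v x"
  shows "gen_series (h ` S) e w = gen_series S d v"
proof (rule fps_ext)
  fix k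
  have "{y \<in> h ` S. e y = k} = h ` {x \<in> S. d x = k}"
    using assms(2) by auto
  moreover have "inj_on h {x \<in> S. d x = k}"
    using assms(1) by (rule inj_on_subset) auto
  ultimately show "fps_nth (gen_series (h ` S) e w) k = fps_nth (gen_series S d v) k"
    using assms(3) by (simp add: gen_series_nth sum.reindex)
qed

lemma gen_series_Un:
  assumes "finite_levels S d" "finite_levels T d" "S \<inter> T = {}"
  shows "gen_series (S \<union> T) d v = gen_series S d v + gen_series T d v"
proof (rule fps_ext)
  fix k
  have "{x \<in> S \<union> T. d x = k} = {x \<in> S. d x = k} \<union> {x \<in> T. d x = k}"
    by auto
  then show "fps_nth (gen_series (S \<union> T) d v) k = fps_nth (gen_series S d v + gen_series T d v) k"
    using assms by (auto simp: gen_series_nth finite_levels_def intro!: sum.union_disjoint)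
qed

text \<open>Convergence is checked coefficientwise: the coefficient at \<open>k\<close> is constant
  as soon as the finite partial sum contains the whole level \<open>k\<close>.\<close>

lemma gen_series_has_sum:
  fixes v :: "'x \<Rightarrow> 'b::ring_1"
  assumes fin: "finite_levels S d"
  shows "((\<lambda>x. fps_const (v x) * fps_X ^ d x) has_sum gen_series S d v) S"
  unfolding has_sum_def
proof (rule tendsto_fpsI)
  fix k
  have "fps_nth (\<Sum>x\<in>F. fps_const (v x) * fps_X ^ d x) k = fps_nth (gen_series S d v) k"
    if F: "finite F" "F \<subseteq> S" "{x \<in> S. d x = k} \<subseteq> F" for F
  proof -
    have "fps_nth (\<Sum>x\<in>F. fps_const (v x) * fps_X ^ d x) k = (\<Sum>x\<in>F. if d x = k then v x else 0)"
      unfolding fps_sum_nth by (rule sum.cong) (auto simp: fps_X_power_nth)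
    also have "\<dots> = (\<Sum>x | x \<in> F \<and> d x = k. v x)"
      using F by (simp add: sum.inter_filter)
    also have "{x \<in> F. d x = k} = {x \<in> S. d x = k}"
      using F by auto
    finally show ?thesis
      by (simp add: gen_series_nth)
  qed
  then show "\<forall>\<^sub>F F in finite_subsets_at_top S.
      fps_nth (\<Sum>x\<in>F. fps_const (v x) * fps_X ^ d x) k = fps_nth (gen_series S d v) k"
    unfolding eventually_finite_subsets_at_top
    using fin by (intro exI[of _ "{x \<in> S. d x = k}"]) (auto simp: finite_levels_def)
qed


subsection \<open>Young subgroups\<close>

text \<open>For an equivalence \<open>R\<close> this is the Young subgroup preserving each class.
  \<open>R\<close> lives on all natural numbers, so it can stay fixed while \<open>n\<close> varies
  in an induction.\<close>

definition young :: "nat \<Rightarrow> (nat \<times> nat) set \<Rightarrow> nat perm set" where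
  "young n R = {\<sigma> \<in> Sym n. \<forall>x. (x, \<sigma> \<langle>$\<rangle> x) \<in> R}"

lemma young_UNIV: "young n UNIV = Sym n"
  by (simp add: young_def)

lemma finite_Sym: "finite (Sym n)"
proof (rule finite_imageD)
  have "(\<langle>$\<rangle>) \<sigma> permutes {1..n}" if "\<sigma> \<in> Sym n" for \<sigma>
    unfolding permutes_def
    using that bij_apply[of \<sigma>] by (auto simp: bij_iff Sym_def in_affected)
  then have "(\<langle>$\<rangle>) ` Sym n \<subseteq> {p. p permutes {1..n}}"
    by blast
  then show "finite ((\<langle>$\<rangle>) ` Sym n)"
    using finite_permutations[of "{1..n}"] finite_subset by blast
  show "inj_on (\<langle>$\<rangle>) (Sym n)"
    by (auto intro!: inj_onI simp: perm_eq_iff)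
qed

lemma finite_young: "finite (young n R)"
  using finite_Sym by (rule finite_subset[rotated]) (auto simp: young_def)

lemma finite_levels_young: "finite_levels (young n R) perm_depth"
  by (simp add: finite_levels_def finite_young)

lemma one_in_young:
  assumes "equiv UNIV R"
  shows "1 \<in> young n R"
  using assms by (simp add: young_def Sym_def equiv_def refl_on_def)

lemma mult_in_young:
  assumes "equiv UNIV R" "\<sigma> \<in> young n R" "\<tau> \<in> young n R"
  shows "\<sigma> * \<tau> \<in> young n R"
  unfolding young_def Sym_def
proof (intro CollectI conjI allI)
  show "affected (\<sigma> * \<tau>) \<subseteq> {1..n}"
    using assms by (intro subset_trans[OF affected_times]) (auto simp: young_def Sym_def)
  fix x
  have "(x, \<tau> \<langle>$\<rangle> x) \<in> R" "(\<tau> \<langle>$\<rangle> x, \<sigma> \<langle>$\<rangle> (\<tau> \<langle>$\<rangle> x)) \<in> R"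
    using assms by (auto simp: young_def)
  then show "(x, (\<sigma> * \<tau>) \<langle>$\<rangle> x) \<in> R"
    using assms(1) unfolding apply_times comp_apply equiv_def by (blast dest: transD)
qed

lemma inverse_in_young:
  assumes "equiv UNIV R" "\<sigma> \<in> young n R"
  shows "inverse \<sigma> \<in> young n R"
  unfolding young_def Sym_def
proof (intro CollectI conjI allI)
  show "affected (inverse \<sigma>) \<subseteq> {1..n}"
    using assms by (simp add: young_def Sym_def)
  fix x
  have "(inverse \<sigma> \<langle>$\<rangle> x, \<sigma> \<langle>$\<rangle> (inverse \<sigma> \<langle>$\<rangle> x)) \<in> R"
    using assms(2) by (simp only: young_def mem_Collect_eq)
  then have "(inverse \<sigma> \<langle>$\<rangle> x, x) \<in> R"
    by (simp only: apply_sequence perm.right_inverse apply_one id_apply)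
  then show "(x, inverse \<sigma> \<langle>$\<rangle> x) \<in> R"
    using assms(1) unfolding equiv_def by (blast dest: symD)
qed

lemma perm_cycles_in_young:
  assumes "equiv UNIV R" "\<sigma> \<in> young n R" "c \<in> perm_cycles \<sigma>"
  shows "c \<in> young n R"
  unfolding young_def Sym_def
proof (intro CollectI conjI allI)
  show "affected c \<subseteq> {1..n}"
    using assms affected_perm_cycle[of c \<sigma>] by (auto simp: young_def Sym_def)
  fix x show "(x, c \<langle>$\<rangle> x) \<in> R"
  proof (cases "x \<in> affected c")
    case True
    then have "c \<langle>$\<rangle> x = \<sigma> \<langle>$\<rangle> x" using assms by (simp add: perm_cycles_def)
    then show ?thesis using assms by (simp add: young_def)
  next
    case False
    then show ?thesis using assms(1) by (simp add: in_affected equiv_def refl_on_def)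
  qed
qed


subsection \<open>Cycle factorizations up to commutation\<close>

text \<open>\<open>in_front c f\<close> says that \<open>c\<close> can be commuted to the first position of \<open>f\<close>.\<close>

primrec in_front :: "nat perm \<Rightarrow> nat perm list \<Rightarrow> bool" where
  "in_front c [] \<longleftrightarrow> False"
| "in_front c (x # f) \<longleftrightarrow> c = x \<or> affected c \<inter> affected x = {} \<and> in_front c f"

section \<open>Commutation classes of words and their first letters\<close>

lemma commutation_equiv_refl: "(f, f) \<in> commutation_equiv"
  by (simp add: commutation_equiv_def)

lemma commutation_equiv_sym: "(f, g) \<in> commutation_equiv \<Longrightarrow> (g, f) \<in> commutation_equiv"
  using equiv_commutation_equiv by (auto simp: equiv_def dest: symD)

lemma commutation_equiv_trans:
  "(f, g) \<in> commutation_equiv \<Longrightarrow> (g, h) \<in> commutation_equiv \<Longrightarrow> (f, h) \<in> commutation_equiv"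
  using equiv_commutation_equiv by (auto simp: equiv_def dest: transD)

lemma commutation_step_Cons: "(f, g) \<in> commutation_step \<Longrightarrow> (c # f, c # g) \<in> commutation_step"
proof -
  assume "(f, g) \<in> commutation_step"
  then obtain xs ys \<sigma> \<tau> where "f = xs @ [\<sigma>, \<tau>] @ ys" "g = xs @ [\<tau>, \<sigma>] @ ys"
    "affected \<sigma> \<inter> affected \<tau> = {}"
    unfolding commutation_step_def by blast
  then have "c # f = (c # xs) @ [\<sigma>, \<tau>] @ ys" "c # g = (c # xs) @ [\<tau>, \<sigma>] @ ys"
    "affected \<sigma> \<inter> affected \<tau> = {}"
    by auto
  then show ?thesis
    unfolding commutation_step_def by blast
qed

lemma commutation_equiv_Cons:
  assumes "(f, g) \<in> commutation_equiv"
  shows "(c # f, c # g) \<in> commutation_equiv"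
  using assms unfolding commutation_equiv_def
  by (induction rule: rtrancl_induct) (auto intro: rtrancl_into_rtrancl commutation_step_Cons)

lemma commutation_equiv_swap:
  "affected \<sigma> \<inter> affected \<tau> = {} \<Longrightarrow> (\<sigma> # \<tau> # f, \<tau> # \<sigma> # f) \<in> commutation_equiv"
proof -
  assume "affected \<sigma> \<inter> affected \<tau> = {}"
  moreover have "\<sigma> # \<tau> # f = [] @ [\<sigma>, \<tau>] @ f" "\<tau> # \<sigma> # f = [] @ [\<tau>, \<sigma>] @ f"
    by simp_all
  ultimately show ?thesis
    unfolding commutation_equiv_def commutation_step_def by blast
qed

lemma in_front_cong_aux:
  assumes "affected \<sigma> \<inter> affected \<tau> = {}"
  shows "in_front c (xs @ [\<sigma>, \<tau>] @ ys) \<longleftrightarrow> in_front c (xs @ [\<tau>, \<sigma>] @ ys)"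
  using assms by (induction xs) auto

lemma in_front_cong:
  assumes "(f, g) \<in> commutation_equiv"
  shows "in_front c f \<longleftrightarrow> in_front c g"
  using assms unfolding commutation_equiv_def
proof (induction rule: rtrancl_induct)
  case (step g h)
  then show ?case
    using in_front_cong_aux unfolding commutation_step_def by blast
qed simp

lemma remove1_cong_aux:
  assumes "affected \<sigma> \<inter> affected \<tau> = {}"
  shows "(remove1 c (xs @ [\<sigma>, \<tau>] @ ys), remove1 c (xs @ [\<tau>, \<sigma>] @ ys)) \<in> commutation_equiv"
proof (induction xs)
  case Nil
  show ?case
    using assms by (auto simp: commutation_equiv_refl intro: commutation_equiv_swap)
next
  case (Cons x xs)
  have "(xs @ [\<sigma>, \<tau>] @ ys, xs @ [\<tau>, \<sigma>] @ ys) \<in> commutation_equiv"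
    unfolding commutation_equiv_def commutation_step_def using assms by blast
  with Cons show ?case
    by (auto intro: commutation_equiv_Cons)
qed

text \<open>This makes cancelling a front letter well defined on classes: commuting neighbours
  affect the leftmost \<open>c\<close> only by shifting its position.\<close>

lemma remove1_cong:
  assumes "(f, g) \<in> commutation_equiv"
  shows "(remove1 c f, remove1 c g) \<in> commutation_equiv"
proof -
  have "(f, g) \<in> commutation_step\<^sup>*"
    using assms by (simp add: commutation_equiv_def)
  then show ?thesis
  proof (induction rule: rtrancl_induct)
    case (step g h)
    then have "(remove1 c g, remove1 c h) \<in> commutation_equiv"
      using remove1_cong_aux unfolding commutation_step_def by blast
    with step show ?case
      using commutation_equiv_trans by blast
  qed (rule commutation_equiv_refl)
qed

text \<open>Every letter before the leftmost \<open>c\<close> is disjoint from \<open>c\<close>, so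
  that occurrence can be commuted to the front.\<close>

lemma Cons_remove1_in_front:
  assumes "in_front c f"
  shows "(c # remove1 c f, f) \<in> commutation_equiv"
  using assms
proof (induction f)
  case (Cons x f)
  show ?case
  proof (cases "x = c")
    case False
    with Cons have disj: "affected c \<inter> affected x = {}" and "in_front c f" by auto
    then have "(x # c # remove1 c f, x # f) \<in> commutation_equiv"
      using Cons by (simp add: commutation_equiv_Cons)
    then show ?thesis
      using False commutation_equiv_swap[OF disj] commutation_equiv_trans by auto
  qed (simp add: commutation_equiv_refl)
qed simp

section \<open>The sign-reversing involution\<close>

lemma in_front_in_set: "in_front c f \<Longrightarrow> c \<in> set f"
  by (induction f) auto

text \<open>The cycles that may be moved in one of the two directions: out of
  \<open>\<sigma>\<close>, or out of \<open>f\<close> into \<open>\<sigma>\<close> while remaining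
  disjoint from it.\<close>

definition front :: "nat perm \<Rightarrow> nat perm list \<Rightarrow> nat perm set" where
  "front \<sigma> f = perm_cycles \<sigma> \<union> {c. in_front c f \<and> affected c \<inter> affected \<sigma> = {}}"

text \<open>The set of movable cycles does not change when \<open>c\<close> is moved. This is what
  lets the second toggle select the same cycle as the first.\<close>

lemma front_shift:
  assumes "nontrivial_cycle c" "affected c \<inter> affected \<sigma> = {}"
  shows "front (c * \<sigma>) f = front \<sigma> (c # f)"
  using assms by (auto simp: front_def perm_cycles_mult_disjoint affected_mult_disjoint)

lemma front_cong:
  "(f, g) \<in> commutation_equiv \<Longrightarrow> front \<sigma> f = front \<sigma> g"
  by (simp add: front_def in_front_cong)

text \<open>The selected cycle depends only on the set \<open>front \<sigma> f\<close>, hence is the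
  same for equivalent words and before and after the move.\<close>

definition toggle :: "nat perm \<times> nat perm list \<Rightarrow> nat perm \<times> nat perm list" where
  "toggle = (\<lambda>(\<sigma>, f). let c = (SOME c. c \<in> front \<sigma> f) in
     if c \<in> perm_cycles \<sigma> then (inverse c * \<sigma>, c # f) else (c * \<sigma>, remove1 c f))"

lemma toggle_cong:
  assumes "(f, g) \<in> commutation_equiv"
  shows "fst (toggle (\<sigma>, f)) = fst (toggle (\<sigma>, g))"
    "(snd (toggle (\<sigma>, f)), snd (toggle (\<sigma>, g))) \<in> commutation_equiv"
  using assms front_cong[OF assms, of \<sigma>]
  by (auto simp: toggle_def Let_def commutation_equiv_Cons remove1_cong)

lemma toggle_cases:
  assumes "front \<sigma> f \<noteq> {}"
  obtains (push) c \<sigma>' where "c = (SOME c. c \<in> front \<sigma> f)" "c \<in> perm_cycles \<sigma>" "\<sigma> = c * \<sigma>'"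
      "affected c \<inter> affected \<sigma>' = {}" "toggle (\<sigma>, f) = (\<sigma>', c # f)"
  | (pull) c where "c = (SOME c. c \<in> front \<sigma> f)" "c \<notin> perm_cycles \<sigma>" "in_front c f"
      "affected c \<inter> affected \<sigma> = {}" "toggle (\<sigma>, f) = (c * \<sigma>, remove1 c f)"
proof -
  define c where "c = (SOME c. c \<in> front \<sigma> f)"
  have c: "c \<in> front \<sigma> f"
    unfolding c_def using assms by (simp add: some_in_eq)
  show thesis
  proof (cases "c \<in> perm_cycles \<sigma>")
    case True
    then show ?thesis
      using push[of c "inverse c * \<sigma>"] c_def affected_inverse_mult_perm_cycle[OF True]
      by (simp add: toggle_def Let_def flip: mult.assoc)
  next
    case False
    with c show ?thesis
      using pull[of c] c_def by (simp add: toggle_def Let_def front_def)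
  qed
qed

text \<open>By \<open>front_shift\<close> the same \<open>c\<close> is selected again, and it now
  lies on the other side. The word returns only up to commutation, since \<open>c\<close> may come
  from its interior and is put back at the front.\<close>

lemma toggle_toggle:
  assumes "front \<sigma> f \<noteq> {}" "\<forall>c\<in>set f. nontrivial_cycle c"
  shows "fst (toggle (toggle (\<sigma>, f))) = \<sigma>"
    "(snd (toggle (toggle (\<sigma>, f))), f) \<in> commutation_equiv"
proof -
  have "fst (toggle (toggle (\<sigma>, f))) = \<sigma> \<and>
    (snd (toggle (toggle (\<sigma>, f))), f) \<in> commutation_equiv"
    using assms(1)
  proof (cases rule: toggle_cases)
    case (push c \<sigma>')
    have nc: "nontrivial_cycle c" using push by (simp add: perm_cycles_def)
    have "front \<sigma>' (c # f) = front \<sigma> f"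
      using front_shift[OF nc push(4)] push(3) by simp
    \<comment> \<open>A cycle of \<open>\<sigma>'\<close> would have its support inside that of
      \<open>\<sigma>'\<close>, but \<open>c\<close> is disjoint from \<open>\<sigma>'\<close> and
      moves a point; so the second toggle pulls \<open>c\<close> back.\<close>
    moreover have "c \<notin> perm_cycles \<sigma>'"
      using affected_perm_cycle[of c \<sigma>'] push(4) nontrivial_cycle_affected_nonempty[OF nc] by blast
    ultimately have "toggle (\<sigma>', c # f) = (c * \<sigma>', f)"
      using push(1) by (simp add: toggle_def)
    then show ?thesis
      using push(3,5) by (simp add: commutation_equiv_refl)
  next
    case (pull c)
    have nc: "nontrivial_cycle c"
      using pull assms(2) in_front_in_set by blast
    have eq: "(c # remove1 c f, f) \<in> commutation_equiv"
      by (rule Cons_remove1_in_front[OF pull(3)])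
    have "front (c * \<sigma>) (remove1 c f) = front \<sigma> f"
      using front_shift[OF nc pull(4)] front_cong[OF eq] by simp
    moreover have "c \<in> perm_cycles (c * \<sigma>)"
      using perm_cycles_mult_disjoint[OF nc pull(4)] by simp
    ultimately have "toggle (c * \<sigma>, remove1 c f) = (inverse c * (c * \<sigma>), c # remove1 c f)"
      using pull(1) by (simp add: toggle_def Let_def)
    then show ?thesis
      using pull eq by (simp flip: mult.assoc)
  qed
  then show "fst (toggle (toggle (\<sigma>, f))) = \<sigma>"
    "(snd (toggle (toggle (\<sigma>, f))), f) \<in> commutation_equiv" by auto
qed

section \<open>Target, depth and length under the involution\<close>

definition total_depth :: "nat perm list \<Rightarrow> nat" where
  "total_depth f = (\<Sum>\<sigma>\<leftarrow>f. perm_depth \<sigma>)"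

lemma total_depth_simps [simp]:
  "total_depth [] = 0" "total_depth (c # f) = perm_depth c + total_depth f"
  by (simp_all add: total_depth_def)

lemma total_depth_cong:
  assumes "(f, g) \<in> commutation_equiv"
  shows "total_depth f = total_depth g"
  unfolding total_depth_def sum_mset_sum_list[symmetric] mset_map
    commutation_equiv_invariant(2)[OF assms] ..

lemma length_cong:
  "(f, g) \<in> commutation_equiv \<Longrightarrow> length f = length g"
  using commutation_equiv_invariant(2) mset_eq_length by blast

lemma set_cong:
  "(f, g) \<in> commutation_equiv \<Longrightarrow> set f = set g"
  using commutation_equiv_invariant(2) mset_eq_setD by blast

text \<open>The moved cycle commutes with the rest of the permutation, so it can cross between
  \<open>\<sigma>\<close> and the word without changing the product; depth is additive over disjoint
  factors, and the word gains or loses one letter.\<close>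

lemma toggle_invariants:
  assumes "front \<sigma> f \<noteq> {}" "toggle (\<sigma>, f) = (\<sigma>', f')"
  shows "\<sigma>' * prod_list f' = \<sigma> * prod_list f"
    "perm_depth \<sigma>' + total_depth f' = perm_depth \<sigma> + total_depth f"
    "odd (length f + length f')"
proof -
  have "\<sigma>' * prod_list f' = \<sigma> * prod_list f \<and>
    perm_depth \<sigma>' + total_depth f' = perm_depth \<sigma> + total_depth f \<and> odd (length f + length f')"
    using assms(1)
  proof (cases rule: toggle_cases)
    case (push c \<sigma>'')
    have "\<sigma>'' * c = c * \<sigma>''" using push(4) by (rule perm_mult_commute)
    then show ?thesis
      using push(3,5) assms(2) perm_depth_mult_disjoint[OF push(4)] by (auto simp flip: mult.assoc)
  next
    case (pull c)
    have eq: "(c # remove1 c f, f) \<in> commutation_equiv"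
      by (rule Cons_remove1_in_front[OF pull(3)])
    have "\<sigma> * c = c * \<sigma>" using pull(4) by (rule perm_mult_commute)
    then have "c * \<sigma> * prod_list (remove1 c f) = \<sigma> * prod_list (c # remove1 c f)"
      by (simp flip: mult.assoc)
    then show ?thesis
      using pull(5) assms(2) perm_depth_mult_disjoint[OF pull(4)] total_depth_cong[OF eq]
        length_cong[OF eq] commutation_equiv_invariant(1)[OF eq]
      by (metis add.commute add.left_commute even_Suc fst_conv length_Cons odd_add snd_conv total_depth_simps(2))
  qed
  then show "\<sigma>' * prod_list f' = \<sigma> * prod_list f"
    "perm_depth \<sigma>' + total_depth f' = perm_depth \<sigma> + total_depth f"
    "odd (length f + length f')" by auto
qed

definition cycle_words :: "nat \<Rightarrow> (nat \<times> nat) set \<Rightarrow> nat perm list set" where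
  "cycle_words n R = {f. set f \<subseteq> young n R \<and> (\<forall>c\<in>set f. nontrivial_cycle c)}"

lemma toggle_closed:
  assumes R: "equiv UNIV R" and "front \<sigma> f \<noteq> {}" "\<sigma> \<in> young n R" "f \<in> cycle_words n R"
  shows "fst (toggle (\<sigma>, f)) \<in> young n R" "snd (toggle (\<sigma>, f)) \<in> cycle_words n R"
proof -
  have "fst (toggle (\<sigma>, f)) \<in> young n R \<and> snd (toggle (\<sigma>, f)) \<in> cycle_words n R"
    using assms(2)
  proof (cases rule: toggle_cases)
    case (push c \<sigma>')
    have push': "toggle (\<sigma>, f) = (inverse c * \<sigma>, c # f)"
      using push(3,5) by (simp flip: mult.assoc)
    have "c \<in> young n R" using perm_cycles_in_young[OF R assms(3) push(2)] .
    then show ?thesis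
      using push(2) assms R push' by (auto simp: cycle_words_def perm_cycles_def mult_in_young inverse_in_young)
  next
    case (pull c)
    then have "c \<in> young n R" using assms(4) in_front_in_set by (auto simp: cycle_words_def)
    moreover have "set (remove1 c f) \<subseteq> set f" by (rule set_remove1_subset)
    ultimately show ?thesis
      using pull assms R unfolding cycle_words_def by (auto simp: mult_in_young)
  qed
  then show "fst (toggle (\<sigma>, f)) \<in> young n R" "snd (toggle (\<sigma>, f)) \<in> cycle_words n R"
    by auto
qed

text \<open>Each letter has positive depth. The bound makes the number of classes of a given depth
  finite.\<close>

lemma total_depth_ge_length:
  assumes "\<forall>c\<in>set f. nontrivial_cycle c"
  shows "length f \<le> total_depth f"
  using assms
proof (induction f)
  case (Cons c f)
  then have "perm_depth c > 0"
    by (intro perm_depth_pos) (metis affected_one list.set_intros(1) nontrivial_cycle_affected_nonempty)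
  with Cons show ?case by simp
qed simp

section \<open>Classes and chosen representatives\<close>

definition cls :: "nat perm list \<Rightarrow> nat perm list set" where
  "cls f = commutation_equiv `` {f}"

definition rep :: "nat perm list set \<Rightarrow> nat perm list" where
  "rep t = (SOME f. f \<in> t)"

lemma cls_eq_iff: "cls f = cls g \<longleftrightarrow> (f, g) \<in> commutation_equiv"
  unfolding cls_def using equiv_commutation_equiv by (simp add: eq_equiv_class_iff)

lemma rep_cls: "(f, rep (cls f)) \<in> commutation_equiv"
proof -
  have "f \<in> cls f"
    by (simp add: cls_def commutation_equiv_refl)
  then have "rep (cls f) \<in> cls f"
    unfolding rep_def by (rule someI)
  then show ?thesis
    by (simp add: cls_def)
qed

lemma cls_rep:
  assumes "t \<in> X // commutation_equiv"
  shows "cls (rep t) = t"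
proof -
  obtain f where "t = cls f"
    using assms by (auto simp: quotient_def cls_def)
  then show ?thesis
    using rep_cls cls_eq_iff commutation_equiv_sym by blast
qed

text \<open>For a commutation-closed set of words, membership of a class becomes a condition on its
  chosen representative; filtering classes then reduces to filtering words.\<close>

lemma quotient_commutation_equiv_iff:
  assumes "\<And>f g. (f, g) \<in> commutation_equiv \<Longrightarrow> f \<in> X \<Longrightarrow> g \<in> X"
  shows "t \<in> X // commutation_equiv \<longleftrightarrow> cls (rep t) = t \<and> rep t \<in> X"
proof
  assume t: "t \<in> X // commutation_equiv"
  then obtain f where "f \<in> X" "t = cls f"
    by (auto simp: quotient_def cls_def)
  then show "cls (rep t) = t \<and> rep t \<in> X"
    using cls_rep[OF t] rep_cls[of f] assms by blast
next
  assume "cls (rep t) = t \<and> rep t \<in> X"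
  then show "t \<in> X // commutation_equiv"
    by (metis cls_def quotientI)
qed

lemma cycle_words_closed:
  assumes "(f, g) \<in> commutation_equiv" "f \<in> cycle_words n R"
  shows "g \<in> cycle_words n R"
  using assms set_cong[OF assms(1)] by (simp add: cycle_words_def)

text \<open>The elements of the Cartier--Foata (trace) monoid on the nontrivial cycles of the Young
  subgroup.\<close>

definition traces :: "nat \<Rightarrow> (nat \<times> nat) set \<Rightarrow> nat perm list set set" where
  "traces n R = cycle_words n R // commutation_equiv"

lemma traces_iff: "t \<in> traces n R \<longleftrightarrow> cls (rep t) = t \<and> rep t \<in> cycle_words n R"
  unfolding traces_def by (rule quotient_commutation_equiv_iff) (rule cycle_words_closed)

lemma cls_in_traces: "f \<in> cycle_words n R \<Longrightarrow> cls f \<in> traces n R"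
  unfolding traces_def cls_def by (rule quotientI)

lemma total_depth_rep_cls: "total_depth (rep (cls f)) = total_depth f"
  using total_depth_cong[OF rep_cls] by simp

lemma length_rep_cls: "length (rep (cls f)) = length f"
  using length_cong[OF rep_cls] by simp

lemma prod_list_rep_cls: "prod_list (rep (cls f)) = prod_list f"
  using commutation_equiv_invariant(1)[OF rep_cls] by simp

lemma finite_levels_traces: "finite_levels (traces n R) (\<lambda>t. total_depth (rep t))"
  unfolding finite_levels_def
proof
  fix k
  show "finite {t \<in> traces n R. total_depth (rep t) = k}"
  proof (rule finite_subset)
    show "{t \<in> traces n R. total_depth (rep t) = k} \<subseteq> cls ` {f. set f \<subseteq> young n R \<and> length f \<le> k}"
    proof
      fix t assume t: "t \<in> {t \<in> traces n R. total_depth (rep t) = k}"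
      then have "rep t \<in> cycle_words n R" "cls (rep t) = t"
        by (simp_all add: traces_iff)
      then show "t \<in> cls ` {f. set f \<subseteq> young n R \<and> length f \<le> k}"
        using t total_depth_ge_length[of "rep t"] by (intro image_eqI[of _ _ "rep t"]) (auto simp: cycle_words_def)
    qed
    show "finite (cls ` {f. set f \<subseteq> young n R \<and> length f \<le> k})"
      by (intro finite_imageI finite_lists_length_le finite_young)
  qed
qed

text \<open>The series \<open>A\<close> for the relation \<open>R\<close>, with the sign of
  \<open>-u\<close> absorbed into the coefficient.\<close>

definition perm_series :: "nat \<Rightarrow> (nat \<times> nat) set \<Rightarrow> (nat perm \<Rightarrow>\<^sub>0 rat) fps" where
  "perm_series n R = gen_series (young n R) perm_depth (\<lambda>\<sigma>. Poly_Mapping.single \<sigma> ((-1) ^ perm_depth \<sigma>))"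

text \<open>The sign collects both \<open>(-1)\<close> to the length and the sign of
  \<open>-u\<close> to the depth, leaving a pure power of the variable.\<close>

definition trace_weight :: "nat perm list set \<Rightarrow> nat perm \<Rightarrow>\<^sub>0 rat" where
  "trace_weight t =
     Poly_Mapping.single (prod_list (rep t)) ((-1) ^ (length (rep t) + total_depth (rep t)))"

definition trace_series :: "nat \<Rightarrow> (nat \<times> nat) set \<Rightarrow> (nat perm \<Rightarrow>\<^sub>0 rat) fps" where
  "trace_series n R = gen_series (traces n R) (\<lambda>t. total_depth (rep t)) trace_weight"

definition toggle_class :: "nat perm \<times> nat perm list set \<Rightarrow> nat perm \<times> nat perm list set" where
  "toggle_class = (\<lambda>(\<sigma>, t). (fst (toggle (\<sigma>, rep t)), cls (snd (toggle (\<sigma>, rep t)))))"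

lemma toggle_class_toggle_class:
  assumes "front \<sigma> (rep t) \<noteq> {}" "t \<in> traces n R"
  shows "toggle_class (toggle_class (\<sigma>, t)) = (\<sigma>, t)"
proof -
  obtain \<sigma>' f' where tog: "toggle (\<sigma>, rep t) = (\<sigma>', f')"
    by (metis surj_pair)
  have eq: "(f', rep (cls f')) \<in> commutation_equiv" by (rule rep_cls)
  have nc: "\<forall>c\<in>set (rep t). nontrivial_cycle c"
    using assms(2) by (simp add: traces_iff cycle_words_def)
  note tt = toggle_toggle[OF assms(1) nc, unfolded tog]
  have "fst (toggle (\<sigma>', rep (cls f'))) = \<sigma>"
    using toggle_cong(1)[OF eq, of \<sigma>'] tt(1) by simp
  moreover have "(snd (toggle (\<sigma>', rep (cls f'))), rep t) \<in> commutation_equiv"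
    using toggle_cong(2)[OF eq, of \<sigma>'] tt(2) commutation_equiv_sym commutation_equiv_trans by blast
  then have "cls (snd (toggle (\<sigma>', rep (cls f')))) = t"
    using cls_eq_iff assms(2) traces_iff by metis
  ultimately show ?thesis
    by (simp add: toggle_class_def tog)
qed

text \<open>Reindexing along \<open>\<phi>\<close> turns the sum into its negative, and a rational
  coefficient equal to its negative is 0.\<close>

lemma sum_eq_0_if_involution:
  fixes h :: "'x \<Rightarrow> ('a \<Rightarrow>\<^sub>0 rat)"
  assumes "\<And>x. x \<in> P \<Longrightarrow> \<phi> x \<in> P" "\<And>x. x \<in> P \<Longrightarrow> \<phi> (\<phi> x) = x" "\<And>x. x \<in> P \<Longrightarrow> h (\<phi> x) = - h x"
  shows "sum h P = 0"
proof -
  have "sum h P = (\<Sum>x\<in>P. h (\<phi> x))"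
    by (rule sum.reindex_bij_witness[of _ \<phi> \<phi>]) (auto simp: assms)
  also have "\<dots> = - sum h P"
    by (simp add: assms(3) sum_negf)
  finally have *: "sum h P = - sum h P" .
  show ?thesis
  proof (rule poly_mapping_eqI)
    fix k
    have "Poly_Mapping.lookup (sum h P) k = - Poly_Mapping.lookup (sum h P) k"
      by (subst *) (simp only: lookup_uminus)
    then show "Poly_Mapping.lookup (sum h P) k = Poly_Mapping.lookup 0 k"
      by simp
  qed
qed

lemma single_one_perm: "Poly_Mapping.single (1 :: nat perm) (1 :: rat) = 1"
  using basis_elt_one by (simp add: basis_elt_def)

text \<open>The coefficient at \<open>k\<close> is a signed sum over pairs of total depth
  \<open>k\<close>. For \<open>k = 0\<close> only the identity with the empty word remains; for
  \<open>k > 0\<close> the toggle cancels everything.\<close>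

lemma perm_series_times_trace_series:
  assumes R: "equiv UNIV R"
  shows "perm_series n R * trace_series n R = 1"
proof (rule fps_ext)
  fix k
  define d where "d = (\<lambda>(\<sigma> :: nat perm, t). perm_depth \<sigma> + total_depth (rep t))"
  define h where "h = (\<lambda>(\<sigma>, t). Poly_Mapping.single (\<sigma> * prod_list (rep t))
    ((-1) ^ (length (rep t) + d (\<sigma>, t)) :: rat))"
  define P where "P = {p \<in> young n R \<times> traces n R. d p = k}"
  have "fps_nth (perm_series n R * trace_series n R) k = sum h P"
    unfolding perm_series_def trace_series_def gen_series_mult[OF finite_levels_young finite_levels_traces]
      gen_series_nth P_def h_def d_def trace_weight_def
    by (rule sum.cong) (auto simp: mult_single plus_perm_def power_add mult_ac)
  also have "\<dots> = (if k = 0 then 1 else 0)"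
  proof (cases "k = 0")
    case True
    have "P = {(1 :: nat perm, cls [])}"
    proof (intro equalityI subsetI)
      fix p assume p: "p \<in> P"
      obtain \<sigma> t where st: "p = (\<sigma>, t)" by (cases p)
      have t: "t \<in> traces n R" and "perm_depth \<sigma> = 0" "total_depth (rep t) = 0"
        using p True by (auto simp: P_def d_def st)
      then have "\<sigma> = 1" "rep t = []"
        using perm_depth_pos[of \<sigma>] total_depth_ge_length[of "rep t"]
        by (auto simp: traces_iff cycle_words_def)
      then show "p \<in> {(1 :: nat perm, cls [])}"
        using t st by (metis singletonI traces_iff)
    next
      fix p assume "p \<in> {(1 :: nat perm, cls [])}"
      then show "p \<in> P"
        using True R by (simp add: P_def d_def one_in_young cls_in_traces cycle_words_def total_depth_rep_cls)
    qed
    then show ?thesis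
      using True by (simp add: h_def d_def total_depth_rep_cls length_rep_cls prod_list_rep_cls
          single_one_perm)
  next
    case False
    \<comment> \<open>Positive total depth excludes the identity paired with the empty word: either
      \<open>\<sigma>\<close> has a cycle, or \<open>\<sigma>\<close> is the identity and the first
      letter of the word can be moved into it.\<close>
    have front: "front \<sigma> (rep t) \<noteq> {}" if "(\<sigma>, t) \<in> P" for \<sigma> t
    proof (cases "\<sigma> = 1")
      case True
      then have "rep t \<noteq> []"
        using that False by (auto simp: P_def d_def)
      then show ?thesis
        using True by (cases "rep t") (auto simp: front_def)
    qed (use perm_cycles_nonempty in \<open>simp add: front_def\<close>)
    have "sum h P = 0"
    proof (rule sum_eq_0_if_involution[of _ toggle_class])
      fix p assume p: "p \<in> P"
      obtain \<sigma> t where st: "p = (\<sigma>, t)" by (cases p)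
      obtain \<sigma>' f' where tog: "toggle (\<sigma>, rep t) = (\<sigma>', f')"
        by (metis surj_pair)
      have mem: "\<sigma> \<in> young n R" "t \<in> traces n R" "rep t \<in> cycle_words n R"
        using p st by (auto simp: P_def traces_iff)
      have fr: "front \<sigma> (rep t) \<noteq> {}" using front p st by simp
      note closed = toggle_closed[OF R fr mem(1,3), unfolded tog]
      note inv = toggle_invariants[OF fr tog]
      have tc: "toggle_class p = (\<sigma>', cls f')"
        by (simp add: toggle_class_def st tog)
      have d: "d (\<sigma>', cls f') = d p"
        using inv(2) by (simp add: d_def st total_depth_rep_cls)
      then show "toggle_class p \<in> P"
        using closed p by (simp add: tc P_def cls_in_traces)
      show "toggle_class (toggle_class p) = p"
        using toggle_class_toggle_class[OF fr mem(2)] st by simp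
      \<comment> \<open>The depth is preserved while the parity of the length changes.\<close>
      have "(-1) ^ (length f' + d p) = - ((-1) ^ (length (rep t) + d p) :: rat)"
        using inv(3) by (auto simp: power_add minus_one_power_iff)
      then show "h (toggle_class p) = - h p"
        using inv(1) d unfolding tc by (simp add: h_def st prod_list_rep_cls length_rep_cls single_uminus)
    qed
    with False show ?thesis by simp
  qed
  finally show "fps_nth (perm_series n R * trace_series n R) k = fps_nth 1 k"
    by simp
qed


subsection \<open>Monotone factorizations\<close>

definition monotone_words :: "nat \<Rightarrow> (nat \<times> nat) set \<Rightarrow> nat perm list set" where
  "monotone_words n R = {f \<in> monotone_factorizations n. set f \<subseteq> young n R}"

text \<open>The summands of the Jucys--Murphy element of \<open>b\<close>, restricted to the class
  of \<open>b\<close> in \<open>R\<close>.\<close>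

definition star_swaps :: "nat \<Rightarrow> (nat \<times> nat) set \<Rightarrow> nat perm set" where
  "star_swaps b R = {\<langle>a \<leftrightarrow> b\<rangle> | a. 1 \<le> a \<and> a < b \<and> (a, b) \<in> R}"

lemma swap_in_young_iff:
  assumes R: "equiv UNIV R" and ab: "1 \<le> a" "a < b" "b \<le> n"
  shows "\<langle>a \<leftrightarrow> b\<rangle> \<in> young n R \<longleftrightarrow> (a, b) \<in> R"
proof
  assume "\<langle>a \<leftrightarrow> b\<rangle> \<in> young n R"
  then have "(a, \<langle>a \<leftrightarrow> b\<rangle> \<langle>$\<rangle> a) \<in> R" by (simp only: young_def mem_Collect_eq)
  then show "(a, b) \<in> R" by simp
next
  assume *: "(a, b) \<in> R"
  then have "(b, a) \<in> R" "(x, x) \<in> R" for x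
    using R by (auto simp: equiv_def refl_on_def dest: symD)
  then have "(x, \<langle>a \<leftrightarrow> b\<rangle> \<langle>$\<rangle> x) \<in> R" for x
    using * by (cases "x = a"; cases "x = b") auto
  then show "\<langle>a \<leftrightarrow> b\<rangle> \<in> young n R"
    using ab by (auto simp: young_def Sym_def affected_swap)
qed

text \<open>Translates the restriction to the Young subgroup into a condition on the pairs, where
  the monotonicity is visible.\<close>

lemma monotone_words_alt:
  assumes R: "equiv UNIV R"
  shows "monotone_words n R = {map (\<lambda>(a, b). \<langle>a \<leftrightarrow> b\<rangle>) ps | ps.
    (\<forall>(a, b)\<in>set ps. 1 \<le> a \<and> a < b \<and> b \<le> n \<and> (a, b) \<in> R) \<and> sorted (map snd ps)}"
proof -
  have "set (map (\<lambda>(a, b). \<langle>a \<leftrightarrow> b\<rangle>) ps) \<subseteq> young n R \<longleftrightarrow> (\<forall>(a, b)\<in>set ps. (a, b) \<in> R)"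
    if "\<forall>(a, b)\<in>set ps. 1 \<le> a \<and> a < b \<and> b \<le> n" for ps
    using that swap_in_young_iff[OF R] by (induction ps) auto
  then show ?thesis
    unfolding monotone_words_def monotone_factorizations_def by fast
qed

lemma young_mono: "m \<le> n \<Longrightarrow> young m R \<subseteq> young n R"
  by (auto simp: young_def Sym_def subset_iff)

lemma affected_young: "\<sigma> \<in> young n R \<Longrightarrow> affected \<sigma> \<subseteq> {1..n}"
  by (simp add: young_def Sym_def)

lemma star_swaps_in_young:
  assumes "equiv UNIV R"
  shows "star_swaps (Suc n) R \<subseteq> young (Suc n) R"
  using assms by (auto simp: star_swaps_def swap_in_young_iff)

lemma affected_star_swap: "\<tau> \<in> star_swaps b R \<Longrightarrow> b \<in> affected \<tau>"
  by (auto simp: star_swaps_def affected_swap)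

lemma monotone_words_0: "monotone_words 0 R = {[]}"
proof -
  have "ps = []" if "\<forall>(a, b)\<in>set ps. 1 \<le> a \<and> a < b \<and> b \<le> (0::nat)" for ps
    using that by (cases ps) auto
  then show ?thesis
    unfolding monotone_words_def monotone_factorizations_def by (auto intro!: exI[of _ "[]"])
qed

text \<open>The last upper point is the largest. If it is \<open>Suc n\<close>, the last factor can
  be split off, leaving a monotone word that may still use \<open>Suc n\<close>; otherwise no factor
  moves \<open>Suc n\<close>.\<close>

lemma monotone_words_Suc:
  assumes R: "equiv UNIV R"
  shows "monotone_words (Suc n) R = monotone_words n R \<union>
    (\<lambda>(f, \<tau>). f @ [\<tau>]) ` (monotone_words (Suc n) R \<times> star_swaps (Suc n) R)" (is "?L = ?A \<union> ?B")
proof (intro equalityI subsetI)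
  let ?sw = "\<lambda>(a, b). \<langle>a \<leftrightarrow> b\<rangle> :: nat perm"
  let ?ok = "\<lambda>n ps. \<forall>(a, b)\<in>set ps. 1 \<le> a \<and> a < b \<and> b \<le> n \<and> (a, b) \<in> R"
  note alt = monotone_words_alt[OF R]
  fix f
  {
    assume "f \<in> ?L"
    then obtain ps where ps: "f = map ?sw ps" "?ok (Suc n) ps" "sorted (map snd ps)"
      unfolding alt by blast
    show "f \<in> ?A \<union> ?B"
    proof (cases ps rule: rev_cases)
      case Nil
      then show ?thesis
        unfolding alt using ps by auto
    next
      case (snoc qs p)
      obtain a b where p: "p = (a, b)" by (cases p)
      show ?thesis
      proof (cases "b = Suc n")
        case True
        have "map ?sw qs \<in> ?L"
          unfolding alt using ps snoc by (auto simp: sorted_append)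
        moreover have "\<langle>a \<leftrightarrow> b\<rangle> \<in> star_swaps (Suc n) R"
          using ps snoc p True by (auto simp: star_swaps_def)
        ultimately show ?thesis
          using ps(1) snoc p by (intro UnI2 image_eqI[of _ _ "(map ?sw qs, \<langle>a \<leftrightarrow> b\<rangle>)"]) auto
      next
        case False
        \<comment> \<open>By sortedness this bound on the last upper point carries over to all the
          others.\<close>
        have "b \<le> n" using False ps snoc p by auto
        then have "?ok n ps"
          using ps snoc p by (fastforce simp: sorted_append)
        then have "f \<in> ?A"
          unfolding alt using ps by blast
        then show ?thesis by simp
      qed
    qed
  next
    assume "f \<in> ?A \<union> ?B"
    then show "f \<in> ?L"
    proof
      assume "f \<in> ?A"
      then obtain ps where ps: "f = map ?sw ps" "?ok n ps" "sorted (map snd ps)"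
        unfolding alt by blast
      moreover have "?ok (Suc n) ps"
        using ps(2) by (auto simp: le_Suc_eq)
      ultimately show ?thesis
        unfolding alt by blast
    next
      assume "f \<in> ?B"
      then obtain g \<tau> where g: "f = g @ [\<tau>]" "g \<in> ?L" "\<tau> \<in> star_swaps (Suc n) R"
        by auto
      obtain ps where "g = map ?sw ps" "?ok (Suc n) ps" "sorted (map snd ps)"
        using g(2) unfolding alt by blast
      moreover obtain a where "\<tau> = \<langle>a \<leftrightarrow> Suc n\<rangle>" "1 \<le> a" "a < Suc n" "(a, Suc n) \<in> R"
        using g(3) unfolding star_swaps_def by blast
      ultimately have ps: "f = map ?sw ps @ [\<langle>a \<leftrightarrow> Suc n\<rangle>]" "?ok (Suc n) ps" "sorted (map snd ps)"
        "1 \<le> a" "a < Suc n" "(a, Suc n) \<in> R"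
        using g(1) by simp_all
      have "?ok (Suc n) (ps @ [(a, Suc n)])" "sorted (map snd (ps @ [(a, Suc n)]))"
        using ps by (auto simp: sorted_append)
      moreover have "f = map ?sw (ps @ [(a, Suc n)])"
        using ps by simp
      ultimately show ?thesis
        unfolding alt by blast
    qed
  }
qed

section \<open>Enlarging the Young subgroup by one point\<close>

lemma young_0:
  assumes "equiv UNIV R"
  shows "young 0 R = {1}"
  using one_in_young[OF assms] by (auto simp: young_def Sym_def)

text \<open>If \<open>\<sigma>\<close> sends \<open>Suc n\<close> to \<open>a\<close>, then left
  multiplication by \<open>\<langle>a \<leftrightarrow> Suc n\<rangle>\<close> makes
  \<open>Suc n\<close> a fixed point. These are coset representatives given by the image of the new
  point.\<close>

lemma young_Suc:
  assumes R: "equiv UNIV R"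
  shows "young (Suc n) R = young n R \<union> (\<lambda>(\<tau>, \<sigma>). \<tau> * \<sigma>) ` (star_swaps (Suc n) R \<times> young n R)"
    (is "?L = ?A \<union> ?B")
proof (intro equalityI subsetI)
  fix \<sigma>
  {
    assume \<sigma>: "\<sigma> \<in> ?L"
    define a where "a = \<sigma> \<langle>$\<rangle> (Suc n)"
    define \<sigma>' where "\<sigma>' = \<langle>a \<leftrightarrow> Suc n\<rangle> * \<sigma>"
    have fixed: "\<tau> \<in> ?A" if "\<tau> \<in> ?L" "\<tau> \<langle>$\<rangle> (Suc n) = Suc n" for \<tau>
    proof -
      have "Suc n \<notin> affected \<tau>" using that by (simp add: in_affected)
      then have "affected \<tau> \<subseteq> {1..n}"
        using affected_young[OF that(1)] by (auto simp: subset_iff le_Suc_eq)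
      then show ?thesis using that by (simp add: young_def Sym_def)
    qed
    show "\<sigma> \<in> ?A \<union> ?B"
    proof (cases "a = Suc n")
      case True
      then show ?thesis using fixed[OF \<sigma>] by (simp add: a_def)
    next
      case False
      have "Suc n \<in> affected \<sigma>"
        using False by (simp add: a_def in_affected)
      then have "a \<in> affected \<sigma>"
        by (simp add: a_def)
      then have a: "1 \<le> a" "a < Suc n"
        using affected_young[OF \<sigma>] False by auto
      have "(Suc n, a) \<in> R"
        using \<sigma> unfolding a_def by (simp add: young_def)
      then have aR: "(a, Suc n) \<in> R"
        using R by (auto simp: equiv_def dest: symD)
      then have sw: "\<langle>a \<leftrightarrow> Suc n\<rangle> \<in> star_swaps (Suc n) R"
        using a by (auto simp: star_swaps_def)
      have "\<sigma>' \<in> ?L"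
        unfolding \<sigma>'_def by (rule mult_in_young[OF R _ \<sigma>]) (use star_swaps_in_young[OF R] sw in blast)
      moreover have "\<sigma>' \<langle>$\<rangle> (Suc n) = Suc n"
        by (simp add: \<sigma>'_def apply_times a_def[symmetric])
      ultimately have "\<sigma>' \<in> ?A" by (rule fixed)
      moreover have "\<sigma> = \<langle>a \<leftrightarrow> Suc n\<rangle> * \<sigma>'"
        by (simp add: \<sigma>'_def flip: mult.assoc)
      ultimately show ?thesis
        using sw by (intro UnI2 image_eqI[of _ _ "(\<langle>a \<leftrightarrow> Suc n\<rangle>, \<sigma>')"]) auto
    qed
  next
    assume "\<sigma> \<in> ?A \<union> ?B"
    then show "\<sigma> \<in> ?L"
    proof
      assume "\<sigma> \<in> ?A"
      then show ?thesis using young_mono[of n "Suc n" R] by auto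
    next
      assume "\<sigma> \<in> ?B"
      then obtain \<tau> \<sigma>' where *: "\<sigma> = \<tau> * \<sigma>'" "\<tau> \<in> star_swaps (Suc n) R" "\<sigma>' \<in> young n R"
        by auto
      then have "\<tau> \<in> ?L" "\<sigma>' \<in> ?L"
        using star_swaps_in_young[OF R, of n] young_mono[of n "Suc n" R] by auto
      then show ?thesis
        unfolding *(1) by (rule mult_in_young[OF R])
    qed
  }
qed

definition monotone_series :: "nat \<Rightarrow> (nat \<times> nat) set \<Rightarrow> (nat perm \<Rightarrow>\<^sub>0 rat) fps" where
  "monotone_series n R = gen_series (monotone_words n R) length (\<lambda>f. basis_elt (prod_list f))"

text \<open>The variable times the restricted Jucys--Murphy element, since every transposition has
  weight 1.\<close>

definition jucys_murphy_series :: "nat \<Rightarrow> (nat \<times> nat) set \<Rightarrow> (nat perm \<Rightarrow>\<^sub>0 rat) fps" where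
  "jucys_murphy_series b R = gen_series (star_swaps b R) (\<lambda>_. 1) basis_elt"

lemma finite_levels_star_swaps: "finite_levels (star_swaps b R) (\<lambda>_. 1)"
proof -
  have "finite ((\<lambda>a. \<langle>a \<leftrightarrow> b\<rangle>) ` {..<b})" by simp
  then have "finite (star_swaps b R)"
    by (rule finite_subset[rotated]) (auto simp: star_swaps_def)
  then show ?thesis by (simp add: finite_levels_def)
qed

lemma finite_levels_monotone_words: "finite_levels (monotone_words n R) length"
  unfolding finite_levels_def
proof
  fix k
  show "finite {f \<in> monotone_words n R. length f = k}"
    by (rule finite_subset[OF _ finite_lists_length_eq[OF finite_young[of n R], of k]])
      (auto simp: monotone_words_def)
qed

lemma finite_levels_subset: "finite_levels S d \<Longrightarrow> T \<subseteq> S \<Longrightarrow> finite_levels T d"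
  unfolding finite_levels_def
proof
  fix k
  assume *: "\<forall>k. finite {x \<in> S. d x = k}" "T \<subseteq> S"
  show "finite {x \<in> T. d x = k}"
    by (rule finite_subset[OF _ *(1)[rule_format, of k]]) (use *(2) in blast)
qed

text \<open>Splitting off a last factor that moves \<open>Suc n\<close> contributes the
  Jucys--Murphy series on the right. The two parts are disjoint because words over
  \<open>{1..n}\<close> have no such factor.\<close>

lemma monotone_series_Suc:
  assumes R: "equiv UNIV R"
  shows "monotone_series (Suc n) R = monotone_series n R + monotone_series (Suc n) R * jucys_murphy_series (Suc n) R"
proof -
  let ?h = "\<lambda>(f, \<tau>). f @ [\<tau> :: nat perm]"
  let ?P = "monotone_words (Suc n) R \<times> star_swaps (Suc n) R"
  have disj: "monotone_words n R \<inter> ?h ` ?P = {}"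
    using affected_young affected_star_swap by (fastforce simp: monotone_words_def)
  have fin: "finite_levels (monotone_words n R) length" "finite_levels (?h ` ?P) length"
    using finite_levels_subset[OF finite_levels_monotone_words[of "Suc n" R]] monotone_words_Suc[OF R, of n]
    by blast+
  have "gen_series (?h ` ?P) length (\<lambda>f. basis_elt (prod_list f)) =
      gen_series ?P (\<lambda>(f, \<tau>). length f + 1) (\<lambda>(f, \<tau>). basis_elt (prod_list f) * basis_elt \<tau>)"
    by (rule gen_series_image) (auto simp: inj_on_def basis_elt_mult)
  also have "\<dots> = monotone_series (Suc n) R * jucys_murphy_series (Suc n) R"
    unfolding monotone_series_def jucys_murphy_series_def
    by (subst gen_series_mult[OF finite_levels_monotone_words finite_levels_star_swaps]) simp
  finally show ?thesis
    using gen_series_Un[OF fin disj, of "\<lambda>f. basis_elt (prod_list f)", folded monotone_words_Suc[OF R, of n]]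
    unfolding monotone_series_def by simp
qed

text \<open>Each transposition moving \<open>Suc n\<close> raises the depth by one and so
  contributes a minus sign; it is split off on the left.\<close>

lemma perm_series_Suc:
  assumes R: "equiv UNIV R"
  shows "perm_series (Suc n) R = (1 - jucys_murphy_series (Suc n) R) * perm_series n R"
proof -
  let ?h = "\<lambda>(\<tau>, \<sigma>). \<tau> * \<sigma> :: nat perm"
  let ?P = "star_swaps (Suc n) R \<times> young n R"
  let ?w = "\<lambda>\<sigma>. Poly_Mapping.single \<sigma> ((-1) ^ perm_depth \<sigma>) :: nat perm \<Rightarrow>\<^sub>0 rat"
  have not: "Suc n \<notin> affected \<sigma>" if "\<sigma> \<in> young n R" for \<sigma>
    using affected_young[OF that] by auto
  have dep: "perm_depth (\<tau> * \<sigma>) = Suc (perm_depth \<sigma>)" if "\<tau> \<in> star_swaps (Suc n) R" "\<sigma> \<in> young n R" for \<tau> \<sigma>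
    using that perm_depth_swap_times[OF not[OF that(2)]] by (auto simp: star_swaps_def)
  \<comment> \<open>The image of \<open>Suc n\<close> recovers \<open>a\<close>, which gives both
    the injectivity of the decomposition and its disjointness from \<open>young n R\<close>.\<close>
  have app: "(\<langle>a \<leftrightarrow> Suc n\<rangle> * \<sigma>) \<langle>$\<rangle> (Suc n) = a" if "\<sigma> \<in> young n R" for \<sigma> a
    using not[OF that] by (simp add: apply_times in_affected)
  have inj: "inj_on ?h ?P"
  proof (rule inj_onI)
    fix p q assume pq: "p \<in> ?P" "q \<in> ?P" "?h p = ?h q"
    obtain a \<sigma> where p: "p = (\<langle>a \<leftrightarrow> Suc n\<rangle>, \<sigma>)" "\<sigma> \<in> young n R"
      using pq(1) by (auto simp: star_swaps_def)
    obtain b \<tau> where q: "q = (\<langle>b \<leftrightarrow> Suc n\<rangle>, \<tau>)" "\<tau> \<in> young n R"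
      using pq(2) by (auto simp: star_swaps_def)
    have eq: "\<langle>a \<leftrightarrow> Suc n\<rangle> * \<sigma> = \<langle>b \<leftrightarrow> Suc n\<rangle> * \<tau>"
      using pq(3) p q by simp
    then have "a = b" using app p q by metis
    then have "\<langle>a \<leftrightarrow> Suc n\<rangle> * (\<langle>a \<leftrightarrow> Suc n\<rangle> * \<sigma>) = \<langle>a \<leftrightarrow> Suc n\<rangle> * (\<langle>a \<leftrightarrow> Suc n\<rangle> * \<tau>)"
      using eq by simp
    then have "\<sigma> = \<tau>" by (simp flip: mult.assoc)
    with \<open>a = b\<close> show "p = q" using p q by simp
  qed
  have disj: "young n R \<inter> ?h ` ?P = {}"
  proof (rule ccontr)
    assume "\<not> ?thesis"
    then obtain a \<sigma> where "a < Suc n" "\<sigma> \<in> young n R" "\<langle>a \<leftrightarrow> Suc n\<rangle> * \<sigma> \<in> young n R"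
      by (auto simp: star_swaps_def)
    then show False
      using app[of \<sigma> a] not[of "\<langle>a \<leftrightarrow> Suc n\<rangle> * \<sigma>"] by (simp add: in_affected)
  qed
  have fin: "finite_levels (?h ` ?P) perm_depth"
    using finite_levels_subset[OF finite_levels_young[of "Suc n" R]] young_Suc[OF R, of n] by blast
  have "gen_series (?h ` ?P) perm_depth ?w =
      gen_series ?P (\<lambda>(\<tau>, \<sigma>). 1 + perm_depth \<sigma>) (\<lambda>(\<tau>, \<sigma>). - basis_elt \<tau> * ?w \<sigma>)"
    using inj by (rule gen_series_image)
      (auto simp: dep basis_elt_def mult_single plus_perm_def single_uminus)
  also have "\<dots> = gen_series (star_swaps (Suc n) R) (\<lambda>_. 1) (\<lambda>\<tau>. - basis_elt \<tau>) * perm_series n R"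
    unfolding perm_series_def
    by (subst gen_series_mult[OF finite_levels_star_swaps finite_levels_young]) simp
  also have "gen_series (star_swaps (Suc n) R) (\<lambda>_. 1) (\<lambda>\<tau>. - basis_elt \<tau>) = - jucys_murphy_series (Suc n) R"
    by (rule fps_ext) (simp add: jucys_murphy_series_def gen_series_nth sum_negf)
  finally show ?thesis
    using gen_series_Un[OF finite_levels_young fin disj, of ?w, folded young_Suc[OF R, of n]]
    unfolding perm_series_def by (simp add: left_diff_distrib)
qed

text \<open>The factor \<open>1 - jucys_murphy_series (Suc n) R\<close> stands at the left end of
  \<open>perm_series (Suc n) R\<close>, exactly where it reduces
  \<open>monotone_series (Suc n) R\<close> to \<open>monotone_series n R\<close>; so the product
  does not depend on \<open>n\<close>.\<close>

lemma monotone_series_times_perm_series: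
  assumes R: "equiv UNIV R"
  shows "monotone_series n R * perm_series n R = 1"
proof (induction n)
  case 0
  have "monotone_series 0 R = 1"
    by (rule fps_ext) (simp add: monotone_series_def monotone_words_0 gen_series_nth basis_elt_one Collect_conv_if)
  moreover have "perm_series 0 R = 1"
    by (rule fps_ext) (auto simp: perm_series_def young_0[OF R] gen_series_nth Collect_conv_if single_one_perm)
  ultimately show ?case by simp
next
  case (Suc n)
  have "monotone_series (Suc n) R * (1 - jucys_murphy_series (Suc n) R) = monotone_series n R"
    unfolding right_diff_distrib diff_eq_eq mult_1_right by (rule monotone_series_Suc[OF R])
  then show ?case
    using Suc perm_series_Suc[OF R, of n] by (metis mult.assoc)
qed

text \<open>A left inverse and a right inverse of \<open>perm_series n R\<close> coincide by
  associativity.\<close>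

lemma monotone_series_eq_trace_series:
  assumes R: "equiv UNIV R"
  shows "monotone_series n R = trace_series n R"
proof -
  have "monotone_series n R = monotone_series n R * (perm_series n R * trace_series n R)"
    by (simp only: perm_series_times_trace_series[OF R] mult_1_right)
  also have "\<dots> = trace_series n R"
    by (simp only: mult.assoc[symmetric] monotone_series_times_perm_series[OF R] mult_1_left)
  finally show ?thesis .
qed


subsection \<open>Transitivity and genus\<close>

definition orbit_rel :: "nat perm list \<Rightarrow> (nat \<times> nat) set" where
  "orbit_rel f = {(x, y). \<exists>\<sigma>\<in>generated_subgroup (set f). \<sigma> \<langle>$\<rangle> x = y}"

text \<open>The orbit relation of a transitive factorization: one class \<open>{1..n}\<close>, and
  every other number alone in its class.\<close>

definition block_rel :: "nat \<Rightarrow> (nat \<times> nat) set" where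
  "block_rel n = Id \<union> {1..n} \<times> {1..n}"

lemma equiv_block_rel: "equiv UNIV (block_rel n)"
  by (rule equivI) (auto simp: block_rel_def refl_on_def sym_def trans_def)

lemma equiv_orbit_rel: "equiv UNIV (orbit_rel f)"
proof (rule equivI)
  show "refl (orbit_rel f)"
    unfolding orbit_rel_def refl_on_def by (auto intro!: bexI[of _ 1] generated_subgroup.one)
  show "sym (orbit_rel f)"
  proof (rule symI)
    fix x y assume "(x, y) \<in> orbit_rel f"
    then obtain \<sigma> where \<sigma>: "\<sigma> \<in> generated_subgroup (set f)" "y = \<sigma> \<langle>$\<rangle> x"
      by (auto simp: orbit_rel_def)
    have "inverse \<sigma> \<langle>$\<rangle> y = x"
      unfolding \<sigma>(2) by (simp only: apply_sequence perm.left_inverse apply_one id_apply)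
    then show "(y, x) \<in> orbit_rel f"
      using \<sigma>(1) by (auto simp: orbit_rel_def intro: generated_subgroup.inv)
  qed
  show "trans (orbit_rel f)"
  proof (rule transI)
    fix x y z assume "(x, y) \<in> orbit_rel f" "(y, z) \<in> orbit_rel f"
    then obtain \<sigma> \<tau> where *: "\<sigma> \<in> generated_subgroup (set f)" "\<tau> \<in> generated_subgroup (set f)"
      "y = \<sigma> \<langle>$\<rangle> x" "z = \<tau> \<langle>$\<rangle> y"
      by (auto simp: orbit_rel_def)
    then have "(\<tau> * \<sigma>) \<langle>$\<rangle> x = z" by (simp add: apply_times)
    then show "(x, z) \<in> orbit_rel f"
      using * by (auto simp: orbit_rel_def intro!: bexI[of _ "\<tau> * \<sigma>"] generated_subgroup.mult)
  qed
qed simp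

text \<open>The Young subgroup is a group, so it contains the generated subgroup once it contains
  the factors. Restricting words to \<open>young n R\<close> thus amounts to summing over all orbit
  relations below \<open>R\<close>.\<close>

lemma orbit_rel_subset_iff:
  assumes R: "equiv UNIV R" and f: "set f \<subseteq> Sym n"
  shows "orbit_rel f \<subseteq> R \<longleftrightarrow> set f \<subseteq> young n R"
proof
  assume "orbit_rel f \<subseteq> R"
  then show "set f \<subseteq> young n R"
    using f by (auto simp: orbit_rel_def young_def intro: generated_subgroup.gen)
next
  assume *: "set f \<subseteq> young n R"
  have "\<sigma> \<in> young n R" if "\<sigma> \<in> generated_subgroup (set f)" for \<sigma>
    using that by induction
      (use * R in \<open>auto intro: one_in_young mult_in_young inverse_in_young\<close>)
  then show "orbit_rel f \<subseteq> R"
    by (auto simp: orbit_rel_def young_def)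
qed

lemma young_block_rel: "young n (block_rel n) = Sym n"
proof (intro equalityI subsetI)
  fix \<sigma> assume "\<sigma> \<in> Sym n"
  then have aff: "affected \<sigma> \<subseteq> {1..n}" by (simp add: Sym_def)
  have "(x, \<sigma> \<langle>$\<rangle> x) \<in> block_rel n" for x
  proof (cases "x \<in> affected \<sigma>")
    case True
    then have "x \<in> {1..n}" "\<sigma> \<langle>$\<rangle> x \<in> {1..n}"
      using aff apply_affected[of \<sigma> x] by blast+
    then show ?thesis by (simp add: block_rel_def)
  qed (simp add: block_rel_def in_affected)
  with aff show "\<sigma> \<in> young n (block_rel n)" by (simp add: young_def Sym_def)
qed (simp add: young_def)

lemma orbit_rel_subset_block_rel:
  "set f \<subseteq> Sym n \<Longrightarrow> orbit_rel f \<subseteq> block_rel n"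
  by (simp add: orbit_rel_subset_iff[OF equiv_block_rel] young_block_rel)

lemma transitive_factorization_iff:
  assumes "set f \<subseteq> Sym n"
  shows "transitive_factorization n f \<longleftrightarrow> orbit_rel f = block_rel n"
proof -
  have "transitive_factorization n f \<longleftrightarrow> {1..n} \<times> {1..n} \<subseteq> orbit_rel f"
    unfolding transitive_factorization_def orbit_rel_def by blast
  also have "\<dots> \<longleftrightarrow> block_rel n \<subseteq> orbit_rel f"
    using equiv_orbit_rel[of f] by (auto simp: block_rel_def equiv_def refl_on_def)
  also have "\<dots> \<longleftrightarrow> orbit_rel f = block_rel n"
    using orbit_rel_subset_block_rel[OF assms] by auto
  finally show ?thesis .
qed

text \<open>Moebius inversion without Moebius function: the sum over
  \<open>p x \<subseteq> R\<close> is the part with equality plus the parts for strictly smaller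
  members of \<open>F\<close>, which agree by induction.\<close>

lemma sum_eq_by_subset_sums:
  fixes v :: "'x \<Rightarrow> 'b::ab_group_add" and w :: "'y \<Rightarrow> 'b" and F :: "'r set set"
  assumes fin: "finite X" "finite Y" "finite F"
    and in_F: "p ` X \<subseteq> F" "q ` Y \<subseteq> F"
    and sums: "\<And>R. R \<in> F \<Longrightarrow> (\<Sum>x | x \<in> X \<and> p x \<subseteq> R. v x) = (\<Sum>y | y \<in> Y \<and> q y \<subseteq> R. w y)"
    and R: "R \<in> F"
  shows "(\<Sum>x | x \<in> X \<and> p x = R. v x) = (\<Sum>y | y \<in> Y \<and> q y = R. w y)"
  using R
proof (induction "card {S \<in> F. S \<subset> R}" arbitrary: R rule: less_induct)
  case less
  let ?G = "{S \<in> F. S \<subset> R}"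
  have split: "(\<Sum>x | x \<in> Z \<and> r x \<subseteq> R. u x) =
      (\<Sum>x | x \<in> Z \<and> r x = R. u x) + (\<Sum>S\<in>?G. \<Sum>x | x \<in> Z \<and> r x = S. u x)"
    if "finite Z" "r ` Z \<subseteq> F" for Z :: "'z set" and r and u :: "'z \<Rightarrow> 'b"
  proof -
    have "(\<Sum>S\<in>?G. \<Sum>x | x \<in> Z \<and> r x = S. u x) =
        (\<Sum>S\<in>?G. \<Sum>x\<in>{x \<in> {x \<in> Z. r x \<subset> R}. r x = S}. u x)"
      by (intro sum.cong) auto
    also have "\<dots> = (\<Sum>x | x \<in> Z \<and> r x \<subset> R. u x)"
      using that fin by (intro sum.group) auto
    finally have *: "(\<Sum>S\<in>?G. \<Sum>x | x \<in> Z \<and> r x = S. u x) = (\<Sum>x | x \<in> Z \<and> r x \<subset> R. u x)" .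
    have "{x \<in> Z. r x \<subseteq> R} = {x \<in> Z. r x = R} \<union> {x \<in> Z. r x \<subset> R}"
      by auto
    then show ?thesis
      unfolding * using that by (simp add: sum.union_disjoint disjoint_iff)
  qed
  have "(\<Sum>S\<in>?G. \<Sum>x | x \<in> X \<and> p x = S. v x) = (\<Sum>S\<in>?G. \<Sum>y | y \<in> Y \<and> q y = S. w y)"
  proof (rule sum.cong)
    fix S assume S: "S \<in> ?G"
    \<comment> \<open>The inclusion is strict because \<open>S\<close> belongs to the right side
      only.\<close>
    have "{T \<in> F. T \<subset> S} \<subset> ?G"
      using S by auto
    then have "card {T \<in> F. T \<subset> S} < card ?G"
      using fin(3) by (intro psubset_card_mono) auto
    then show "(\<Sum>x | x \<in> X \<and> p x = S. v x) = (\<Sum>y | y \<in> Y \<and> q y = S. w y)"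
      using S less(1) by simp
  qed simp
  then show ?case
    using split[OF fin(1) in_F(1), of v] split[OF fin(2) in_F(2), of w] sums[OF less(2)] by simp
qed

text \<open>An identity in the group algebra may be restricted to the basis elements satisfying
  \<open>Q\<close>. Here it isolates a genus, which for fixed depth is a condition on the
  target.\<close>

lemma sum_single_filter:
  fixes a :: "'x \<Rightarrow> 'c::comm_monoid_add"
  assumes fin: "finite X" "finite Y"
    and eq: "(\<Sum>x\<in>X. Poly_Mapping.single (p x) (a x)) = (\<Sum>y\<in>Y. Poly_Mapping.single (q y) (b y))"
  shows "(\<Sum>x | x \<in> X \<and> Q (p x). Poly_Mapping.single (p x) (a x)) =
    (\<Sum>y | y \<in> Y \<and> Q (q y). Poly_Mapping.single (q y) (b y))"
proof (rule poly_mapping_eqI)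
  fix s
  have filter: "Poly_Mapping.lookup (\<Sum>z | z \<in> Z \<and> Q (r z). Poly_Mapping.single (r z) (c z)) s =
      (if Q s then Poly_Mapping.lookup (\<Sum>z\<in>Z. Poly_Mapping.single (r z) (c z)) s else 0)"
    if "finite Z" for Z :: "'z set" and r and c :: "'z \<Rightarrow> 'c"
  proof -
    have "Poly_Mapping.lookup (\<Sum>z | z \<in> Z \<and> Q (r z). Poly_Mapping.single (r z) (c z)) s =
        (\<Sum>z\<in>Z. if Q (r z) then c z when r z = s else 0)"
      using that by (simp only: lookup_sum lookup_single sum.inter_filter if_distrib[of "\<lambda>p. Poly_Mapping.lookup p s"]
          lookup_zero)
    also have "\<dots> = (\<Sum>z\<in>Z. if Q s then c z when r z = s else 0)"
      by (rule sum.cong) (auto simp: when_def)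
    also have "\<dots> = (if Q s then Poly_Mapping.lookup (\<Sum>z\<in>Z. Poly_Mapping.single (r z) (c z)) s else 0)"
      by (simp add: lookup_sum lookup_single)
    finally show ?thesis .
  qed
  show "Poly_Mapping.lookup (\<Sum>x | x \<in> X \<and> Q (p x). Poly_Mapping.single (p x) (a x)) s =
    Poly_Mapping.lookup (\<Sum>y | y \<in> Y \<and> Q (q y). Poly_Mapping.single (q y) (b y)) s"
    unfolding filter[OF fin(1)] filter[OF fin(2)] eq ..
qed

section \<open>The original sets of factorizations in terms of words and classes\<close>

lemma factor_monotone_factorization:
  assumes "f \<in> monotone_factorizations n" "\<sigma> \<in> set f"
  obtains a b where "\<sigma> = \<langle>a \<leftrightarrow> b\<rangle>" "1 \<le> a" "a < b" "b \<le> n"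
  using assms by (fastforce simp: monotone_factorizations_def)

lemma monotone_factorizations_in_Sym:
  assumes "f \<in> monotone_factorizations n"
  shows "set f \<subseteq> Sym n"
proof
  fix \<sigma> assume "\<sigma> \<in> set f"
  with assms obtain a b where "\<sigma> = \<langle>a \<leftrightarrow> b\<rangle>" "1 \<le> a" "a < b" "b \<le> n"
    by (rule factor_monotone_factorization)
  then show "\<sigma> \<in> Sym n"
    by (auto simp: Sym_def affected_swap)
qed

lemma monotone_words_UNIV: "monotone_words n UNIV = monotone_factorizations n"
  using monotone_factorizations_in_Sym by (auto simp: monotone_words_def young_UNIV)

lemma total_depth_monotone:
  assumes "f \<in> monotone_factorizations n"
  shows "total_depth f = length f"
proof -
  have "perm_depth \<sigma> = 1" if \<sigma>: "\<sigma> \<in> set f" for \<sigma>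
  proof -
    obtain a b where "\<sigma> = \<langle>a \<leftrightarrow> b\<rangle>" "a < b"
      using assms \<sigma> by (rule factor_monotone_factorization)
    then show ?thesis
      using perm_depth_swap_times[of b 1 a] by simp
  qed
  then show ?thesis
    unfolding total_depth_def by (induction f) auto
qed

lemma cycle_words_UNIV: "cycle_words n UNIV = cycle_factorizations n"
  by (simp add: cycle_words_def cycle_factorizations_def young_UNIV)

lemma traces_filter:
  assumes "\<And>f g. (f, g) \<in> commutation_equiv \<Longrightarrow> P f \<longleftrightarrow> P g"
  shows "{f \<in> cycle_factorizations n. P f} // commutation_equiv = {t \<in> traces n UNIV. P (rep t)}"
proof (rule set_eqI)
  fix t
  have "t \<in> {f \<in> cycle_factorizations n. P f} // commutation_equiv \<longleftrightarrow>
      cls (rep t) = t \<and> rep t \<in> {f \<in> cycle_factorizations n. P f}"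
    by (rule quotient_commutation_equiv_iff)
      (use assms cycle_words_closed[of _ _ n UNIV] in \<open>auto simp: cycle_words_UNIV\<close>)
  then show "t \<in> {f \<in> cycle_factorizations n. P f} // commutation_equiv \<longleftrightarrow>
      t \<in> {t \<in> traces n UNIV. P (rep t)}"
    by (simp add: traces_iff cycle_words_UNIV)
qed

lemma inequivalent_factorizations_eq: "inequivalent_factorizations n = traces n UNIV"
  by (simp add: inequivalent_factorizations_def traces_def cycle_words_UNIV)

lemma transitive_of_genus_cong:
  assumes "(f, g) \<in> commutation_equiv"
  shows "transitive_of_genus n h f \<longleftrightarrow> transitive_of_genus n h g"
  using commutation_equiv_invariant[OF assms] set_cong[OF assms] depth_mset_cong[of f g n]
  by (simp add: transitive_of_genus_def transitive_factorization_def)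

lemma inequivalent_factorizations_of_genus_eq:
  "inequivalent_factorizations_of_genus n g = {t \<in> traces n UNIV. transitive_of_genus n g (rep t)}"
  unfolding inequivalent_factorizations_of_genus_def
  by (rule traces_filter) (rule transitive_of_genus_cong)

lemma traces_eq_filter:
  "traces n R = {t \<in> traces n UNIV. set (rep t) \<subseteq> young n R}"
proof -
  have "young n R \<subseteq> Sym n"
    by (auto simp: young_def)
  then show ?thesis
    unfolding set_eq_iff traces_iff cycle_words_def young_UNIV mem_Collect_eq by blast
qed

section \<open>The transitive parts of the two series\<close>

lemma transitive_of_genus_iff:
  assumes "set f \<subseteq> Sym n"
  shows "transitive_of_genus n g f \<longleftrightarrow> orbit_rel f = block_rel n \<and>
    int (total_depth f) = int n + int (num_cycles n (prod_list f)) - 2 + 2 * int g"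
  by (simp add: transitive_of_genus_def transitive_factorization_iff[OF assms]
      depth_eq_sum_perm_depth[OF assms] total_depth_def)

lemma set_rep_trace: "t \<in> traces n UNIV \<Longrightarrow> set (rep t) \<subseteq> Sym n"
  by (simp add: traces_iff cycle_words_def young_UNIV)

text \<open>In each degree \<open>k\<close>, inversion over equivalence relations first selects
  transitivity, and restricting to suitable targets then selects the genus.\<close>

lemma transitive_series_eq:
  "gen_series {f \<in> monotone_factorizations n. transitive_of_genus n g f} length
      (\<lambda>f. basis_elt (prod_list f)) =
   gen_series {t \<in> traces n UNIV. transitive_of_genus n g (rep t)} (\<lambda>t. total_depth (rep t)) trace_weight"
proof (rule fps_ext)
  fix k
  define X where "X = {f \<in> monotone_factorizations n. length f = k}"
  define Y where "Y = {t \<in> traces n UNIV. total_depth (rep t) = k}"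
  define F where "F = {R. equiv UNIV R \<and> R \<subseteq> block_rel n}"
  \<comment> \<open>The genus equation with the depth replaced by the degree \<open>k\<close>, so
    that it only involves the target.\<close>
  define Q where "Q = (\<lambda>\<sigma>. int k = int n + int (num_cycles n \<sigma>) - 2 + 2 * int g)"
  have XSym: "set f \<subseteq> Sym n" if "f \<in> X" for f
    using that monotone_factorizations_in_Sym by (simp add: X_def)
  have YSym: "set (rep t) \<subseteq> Sym n" if "t \<in> Y" for t
    using that set_rep_trace by (simp add: Y_def)
  have fin: "finite X" "finite Y"
    using finite_levels_monotone_words[of n UNIV] finite_levels_traces[of n UNIV]
    by (simp_all add: finite_levels_def X_def Y_def monotone_words_UNIV)
  \<comment> \<open>A relation below \<open>block_rel n\<close> is determined by its restriction to
    \<open>{1..n}\<close>, which bounds \<open>F\<close>.\<close>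
  have "F \<subseteq> (\<union>) Id ` Pow ({1..n} \<times> {1..n})"
  proof
    fix R assume "R \<in> F"
    then have "R = Id \<union> (R \<inter> {1..n} \<times> {1..n})"
      by (auto simp: F_def block_rel_def equiv_def refl_on_def)
    then show "R \<in> (\<union>) Id ` Pow ({1..n} \<times> {1..n})" by blast
  qed
  then have finF: "finite F"
    by (rule finite_subset) simp
  have "(\<Sum>f | f \<in> X \<and> orbit_rel f = block_rel n. basis_elt (prod_list f)) =
      (\<Sum>t | t \<in> Y \<and> orbit_rel (rep t) = block_rel n. trace_weight t)"
  proof (rule sum_eq_by_subset_sums[OF fin finF])
    show "orbit_rel ` X \<subseteq> F" "(\<lambda>t. orbit_rel (rep t)) ` Y \<subseteq> F"
      using equiv_orbit_rel orbit_rel_subset_block_rel[OF XSym] orbit_rel_subset_block_rel[OF YSym]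
      unfolding F_def by blast+
    show "block_rel n \<in> F"
      using equiv_block_rel by (simp add: F_def)
    fix R assume "R \<in> F"
    then have R: "equiv UNIV R" by (simp add: F_def)
    \<comment> \<open>The sums over orbit relations below \<open>R\<close> are the coefficients at
      \<open>k\<close> of the two series for \<open>R\<close>, whose equality is known.\<close>
    have "{f \<in> X. orbit_rel f \<subseteq> R} = {f \<in> monotone_words n R. length f = k}"
      using orbit_rel_subset_iff[OF R XSym] unfolding X_def monotone_words_def by blast
    moreover have "{t \<in> Y. orbit_rel (rep t) \<subseteq> R} = {t \<in> traces n R. total_depth (rep t) = k}"
      using orbit_rel_subset_iff[OF R YSym] unfolding traces_eq_filter[of n R] Y_def by blast
    ultimately show "(\<Sum>f | f \<in> X \<and> orbit_rel f \<subseteq> R. basis_elt (prod_list f)) =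
        (\<Sum>t | t \<in> Y \<and> orbit_rel (rep t) \<subseteq> R. trace_weight t)"
      using arg_cong[OF monotone_series_eq_trace_series[OF R, of n], of "\<lambda>s. fps_nth s k"]
      by (simp add: monotone_series_def trace_series_def gen_series_nth)
  qed
  then have "(\<Sum>f | f \<in> {f \<in> X. orbit_rel f = block_rel n} \<and> Q (prod_list f). basis_elt (prod_list f)) =
      (\<Sum>t | t \<in> {t \<in> Y. orbit_rel (rep t) = block_rel n} \<and> Q (prod_list (rep t)). trace_weight t)"
    unfolding basis_elt_def trace_weight_def using fin by (intro sum_single_filter) auto
  moreover have "{f \<in> {f \<in> X. orbit_rel f = block_rel n}. Q (prod_list f)} =
      {f \<in> {f \<in> monotone_factorizations n. transitive_of_genus n g f}. length f = k}"
    using XSym by (auto simp: X_def Q_def transitive_of_genus_iff total_depth_monotone)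
  moreover have "{t \<in> {t \<in> Y. orbit_rel (rep t) = block_rel n}. Q (prod_list (rep t))} =
      {t \<in> {t \<in> traces n UNIV. transitive_of_genus n g (rep t)}. total_depth (rep t) = k}"
    using YSym by (auto simp: Y_def Q_def transitive_of_genus_iff)
  ultimately show "fps_nth (gen_series {f \<in> monotone_factorizations n. transitive_of_genus n g f} length
      (\<lambda>f. basis_elt (prod_list f))) k =
   fps_nth (gen_series {t \<in> traces n UNIV. transitive_of_genus n g (rep t)} (\<lambda>t. total_depth (rep t)) trace_weight) k"
    by (simp only: gen_series_nth)
qed

lemma inequivalent_term_eq:
  assumes t: "t \<in> traces n UNIV"
  shows "inequivalent_term n t = fps_const (trace_weight t) * fps_X ^ total_depth (rep t)"
proof -
  have "rep t \<in> t"
    using t rep_cls[of "rep t"] commutation_equiv_refl[of "rep t"] unfolding traces_iff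
    by (metis Image_singleton_iff cls_def)
  note on = on_class_eq[OF t[unfolded traces_def] this]
  have dep: "depth n (rep t) = total_depth (rep t)"
    using depth_eq_sum_perm_depth[OF set_rep_trace[OF t]] by (simp add: total_depth_def)
  show ?thesis
    unfolding inequivalent_term_def on dep
    by (cases "even (length (rep t))"; cases "even (total_depth (rep t))")
      (simp_all add: trace_weight_def basis_elt_def single_uminus fps_const_neg[symmetric] del: fps_const_neg)
qed

text \<open>Reduces each unordered sum identity, including summability, to an equality of generating
  series.\<close>

lemma term_sums:
  assumes M: "M \<subseteq> monotone_factorizations n" and T: "T \<subseteq> traces n UNIV"
    and eq: "gen_series M length (\<lambda>f. basis_elt (prod_list f)) =
      gen_series T (\<lambda>t. total_depth (rep t)) trace_weight"
  shows "monotone_term summable_on M \<and> inequivalent_term n summable_on T \<and>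
    (\<Sum>\<^sub>\<infinity>f\<in>M. monotone_term f) = (\<Sum>\<^sub>\<infinity>t\<in>T. inequivalent_term n t)"
proof -
  have "finite_levels M length"
    using finite_levels_subset[OF finite_levels_monotone_words[of n UNIV]] M by (simp add: monotone_words_UNIV)
  then have 1: "(monotone_term has_sum gen_series M length (\<lambda>f. basis_elt (prod_list f))) M"
    unfolding monotone_term_def by (rule gen_series_has_sum)
  have "finite_levels T (\<lambda>t. total_depth (rep t))"
    using finite_levels_subset[OF finite_levels_traces T] .
  then have "((\<lambda>t. fps_const (trace_weight t) * fps_X ^ total_depth (rep t)) has_sum
      gen_series T (\<lambda>t. total_depth (rep t)) trace_weight) T"
    by (rule gen_series_has_sum)
  then have 2: "(inequivalent_term n has_sum gen_series T (\<lambda>t. total_depth (rep t)) trace_weight) T"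
    using inequivalent_term_eq T by (subst has_sum_cong) auto
  show ?thesis
    using has_sum_imp_summable[OF 1] has_sum_imp_summable[OF 2] infsumI[OF 1] infsumI[OF 2] eq by simp
qed

unbundle no permutation_syntax

theorem theorem3p2:
  fixes n :: nat
  shows "(monotone_term summable_on monotone_factorizations n \<and>
          inequivalent_term n summable_on inequivalent_factorizations n \<and>
          (\<Sum>\<^sub>\<infinity>f\<in>monotone_factorizations n. monotone_term f) =
            (\<Sum>\<^sub>\<infinity>c\<in>inequivalent_factorizations n. inequivalent_term n c)) \<and>
         (\<forall>g::nat.
          monotone_term summable_on {f \<in> monotone_factorizations n. transitive_of_genus n g f} \<and>
          inequivalent_term n summable_on inequivalent_factorizations_of_genus n g \<and>
          (\<Sum>\<^sub>\<infinity>f\<in>{f \<in> monotone_factorizations n. transitive_of_genus n g f}. monotone_term f) =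
            (\<Sum>\<^sub>\<infinity>c\<in>inequivalent_factorizations_of_genus n g. inequivalent_term n c))"
proof (intro conjI[of "_ \<and> _"] allI)
  \<comment> \<open>The full relation imposes no restriction on the factors and yields the identity
    for all factorizations.\<close>
  have "equiv UNIV (UNIV :: (nat \<times> nat) set)"
    by (rule equivI) (auto simp: refl_on_def sym_def trans_def)
  from monotone_series_eq_trace_series[OF this, of n]
  show "monotone_term summable_on monotone_factorizations n \<and>
      inequivalent_term n summable_on inequivalent_factorizations n \<and>
      (\<Sum>\<^sub>\<infinity>f\<in>monotone_factorizations n. monotone_term f) =
        (\<Sum>\<^sub>\<infinity>c\<in>inequivalent_factorizations n. inequivalent_term n c)"
    unfolding inequivalent_factorizations_eq monotone_series_def trace_series_def monotone_words_UNIV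
    by (intro term_sums) auto
  show "monotone_term summable_on {f \<in> monotone_factorizations n. transitive_of_genus n g f} \<and>
      inequivalent_term n summable_on inequivalent_factorizations_of_genus n g \<and>
      (\<Sum>\<^sub>\<infinity>f\<in>{f \<in> monotone_factorizations n. transitive_of_genus n g f}. monotone_term f) =
        (\<Sum>\<^sub>\<infinity>c\<in>inequivalent_factorizations_of_genus n g. inequivalent_term n c)" for g
    unfolding inequivalent_factorizations_of_genus_eq
    by (intro term_sums transitive_series_eq) auto
qed

end
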